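(* Fix a constant $\bar\rho<1/2$. Let $Q\in\mathbb{Q}^{n\times n}$ and $q\in\mathbb{Q}^n$, with $I-Q$ and $I+Q$ nonsingular, be written as $Q=\bar Q/d_Q$, $q=\bar q/d_q$ with $\bar Q\in\mathbb{Z}^{n\times n}$, $\bar q\in\mathbb{Z}^n$, $d_Q,d_q\in\mathbb{Z}_{>0}$, and let $\bar L=\max\{d_q,d_Q,\|\bar q\|_\infty,\|\bar Q\|_{\max}\}$. Assume that the Cayley transform $R=(I-Q)(I+Q)^{-1}$ satisfies $\rho(|R|)\le\bar\rho$. Then the generalized Newton method (GNM) applied to the absolute value equation $$A_{\rm c}x-|x|=b_{\rm c},\qquad A_{\rm c}=(I+Q)(I-Q)^{-1},\quad b_{\rm c}=-2(I-Q)^{-1}q,$$ terminates finitely at its unique solution $x$, which yields the unique solution of the linear complementarity problem: find $u,v\in\mathbb{R}^n$ with $v=Qu+q$, $u,v\ge0$, $u^Tv=0$. The iteration complexity is bounded by: (i) $\mathcal{O}\bigl(n^3\log(n\bar L)\bigr)$; (ii) $\mathcal{O}\bigl(n^2\log(n\bar L)\bigr)$ if additionally $\|R\|_1\le\bar\rho<1/2$.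
   Context: $|X|$ and $|x|$ are entrywise; $\rho(\cdot)$ is the spectral radius; $\|\cdot\|_1$ for matrices is the maximum absolute column sum; $\|\cdot\|_\infty$ for vectors is the maximum absolute entry; $\|X\|_{\max}=\max_{i,j}|X_{ij}|$. The solution $x$ of the absolute value equation yields the solution of the linear complementarity problem via $u=(|x|+x)/2$, $v=(|x|-x)/2$. Note $A_{\rm c}^{-1}=R$. GNM (full-flip algorithm) for $A_{\rm c}x-|x|=b_{\rm c}$: initialize $z\in\{-1,1\}^n$, $Z=\operatorname{Diag}(z)$; compute $x=(A_{\rm c}-Z)^{-1}b_{\rm c}$ and the mismatch set $\mathcal{V}_z=\{i\in\{1,\dots,n\}: z_ix_i<0\}$. While $\mathcal{V}_z\neq\emptyset$: replace $z_i$ by $-z_i$ for all $i\in\mathcal{V}_z$; recompute $Z$, $x$ and $\mathcal{V}_z$. When $\mathcal{V}_z=\emptyset$, return $x$. One pass through the while loop is one iteration. ($A_{\rm c}-Z$ is nonsingular for all $z\in\{-1,1\}^n$ under the stated condition.) The constants implied by $\mathcal{O}$ depend only on the fixed constant $\bar\rho$. *)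

theory Defs
  imports
    "Jordan_Normal_Form.Spectral_Radius"
    "Jordan_Normal_Form.Gauss_Jordan_Elimination"
begin

text \<open>Vectors and matrices are indexed by \<open>{0..<n}\<close> with \<open>n\<close> a natural number, since the
  constants of a complexity bound have to be uniform in \<open>n\<close>.\<close>

text \<open>Meaningful for nonsingular \<open>A\<close> only.\<close>
definition inv_mat :: "real mat \<Rightarrow> real mat" where
  "inv_mat A = the (mat_inverse A)"

definition abs_mat :: "real mat \<Rightarrow> real mat" where
  "abs_mat A = map_mat abs A"

definition abs_vec :: "real vec \<Rightarrow> real vec" where
  "abs_vec x = map_vec abs x"

definition real_spectral_radius :: "real mat \<Rightarrow> real" where
  "real_spectral_radius A = spectral_radius (map_mat complex_of_real A)"

definition one_norm_mat :: "real mat \<Rightarrow> real" where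
  "one_norm_mat A = Max ((\<lambda>j. \<Sum>i<dim_row A. \<bar>A $$ (i, j)\<bar>) ` {..<dim_col A})"

definition max_norm_mat :: "int mat \<Rightarrow> int" where
  "max_norm_mat A = Max (abs ` elements_mat A)"

definition inf_norm_vec :: "int vec \<Rightarrow> int" where
  "inf_norm_vec v = Max (abs ` set\<^sub>v v)"

definition Lbar :: "int mat \<Rightarrow> int vec \<Rightarrow> int \<Rightarrow> int \<Rightarrow> int" where
  "Lbar Qbar qbar dQ dq = Max {dq, dQ, inf_norm_vec qbar, max_norm_mat Qbar}"

definition cayley :: "nat \<Rightarrow> real mat \<Rightarrow> real mat" where
  "cayley n Q = (1\<^sub>m n - Q) * inv_mat (1\<^sub>m n + Q)"

definition ave_mat :: "nat \<Rightarrow> real mat \<Rightarrow> real mat" where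
  "ave_mat n Q = (1\<^sub>m n + Q) * inv_mat (1\<^sub>m n - Q)"

definition ave_rhs :: "nat \<Rightarrow> real mat \<Rightarrow> real vec \<Rightarrow> real vec" where
  "ave_rhs n Q q = (- 2) \<cdot>\<^sub>v (inv_mat (1\<^sub>m n - Q) *\<^sub>v q)"

definition ave_solution :: "nat \<Rightarrow> real mat \<Rightarrow> real vec \<Rightarrow> real vec \<Rightarrow> bool" where
  "ave_solution n A b x \<longleftrightarrow> x \<in> carrier_vec n \<and> A *\<^sub>v x - abs_vec x = b"

definition lcp_solution ::
    "nat \<Rightarrow> real mat \<Rightarrow> real vec \<Rightarrow> real vec \<Rightarrow> real vec \<Rightarrow> bool" where
  "lcp_solution n Q q u v \<longleftrightarrow>
     u \<in> carrier_vec n \<and> v \<in> carrier_vec n \<and>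
     v = Q *\<^sub>v u + q \<and> 0\<^sub>v n \<le> u \<and> 0\<^sub>v n \<le> v \<and> u \<bullet> v = 0"

definition sign_vecs :: "nat \<Rightarrow> real vec set" where
  "sign_vecs n = {z \<in> carrier_vec n. \<forall>i<n. z $ i \<in> {- 1, 1}}"

definition Diag :: "real vec \<Rightarrow> real mat" where
  "Diag z = mat_diag (dim_vec z) (\<lambda>i. z $ i)"

definition gnm_point :: "real mat \<Rightarrow> real vec \<Rightarrow> real vec \<Rightarrow> real vec" where
  "gnm_point A b z = inv_mat (A - Diag z) *\<^sub>v b"

definition mismatch :: "real mat \<Rightarrow> real vec \<Rightarrow> real vec \<Rightarrow> nat set" where
  "mismatch A b z = {i. i < dim_vec z \<and> z $ i * gnm_point A b z $ i < 0}"

definition flip :: "nat set \<Rightarrow> real vec \<Rightarrow> real vec" where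
  "flip V z = vec (dim_vec z) (\<lambda>i. if i \<in> V then - (z $ i) else z $ i)"

text \<open>\<open>gnm_run A b z k x\<close>: the generalized Newton method for \<open>A x - |x| = b\<close>, initialized with
  the sign vector \<open>z\<close>, returns \<open>x\<close> after exactly \<open>k\<close> passes through its while loop.\<close>
inductive gnm_run :: "real mat \<Rightarrow> real vec \<Rightarrow> real vec \<Rightarrow> nat \<Rightarrow> real vec \<Rightarrow> bool"
  for A :: "real mat" and b :: "real vec" where
  stop: "mismatch A b z = {} \<Longrightarrow> gnm_run A b z 0 (gnm_point A b z)"
| pass: "mismatch A b z \<noteq> {} \<Longrightarrow> gnm_run A b (flip (mismatch A b z) z) k x \<Longrightarrow>
         gnm_run A b z (Suc k) x"

end

theory Submission
  imports Defs
begin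

text \<open>
  Write \<open>y = Z x\<close> for the point \<open>x\<close> computed from the sign matrix \<open>Z\<close>, and let \<open>w \<ge> 1\<close> be
  weights with \<open>w\<^sup>T|R| \<le> s w\<^sup>T\<close> for some \<open>\<rho> < s < 1/2\<close>. Two points of the method differ by
  \<open>x' - x = R (y' - y)\<close>, and \<open>|x' - x| = |y' - |y||\<close> entrywise if \<open>Z'\<close> arises from \<open>Z\<close> by a full
  flip. Hence in the \<open>w\<close>-weighted 1-norm \<open>\<parallel>y' - |y|\<parallel> \<le> (2 s / (1 - s)) \<parallel>y\<^sup>-\<parallel>\<close>, where the factor is less
  than 2 because \<open>s < 1/2\<close>. As \<open>|y| = y + 2 y\<^sup>-\<close>, the potential \<open>w\<^sup>T y\<close> increases strictly, and since
  the gap between \<open>w\<^sup>T y\<close> and its final value is at most \<open>(2 / (1 - s)) \<parallel>y\<^sup>-\<parallel>\<close>, this gap shrinks by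
  the factor \<open>2 s\<close> per iteration.

  By Cramer's rule the nonzero entries of all the points \<open>x\<close> lie between \<open>(n L)\<close> to the powers
  \<open>-(n + 1)\<close> and \<open>n + 1\<close>, so there are \<open>O(n log (n L) + log (max w))\<close> iterations. If \<open>\<parallel>R\<parallel>\<^sub>1 \<le> \<rho>\<close>
  take \<open>w = 1\<close>. Otherwise take \<open>w\<^sup>T = 1\<^sup>T (s I - |R|)\<close> inverse; Cramer's rule and
  \<open>|det (s I - |R|)| \<ge> (s - \<rho>)\<close> to the power \<open>n\<close> give \<open>log (max w) = O(n\<^sup>2 log (n L))\<close>.
\<close>

section \<open>Inverses, trivial kernels and sign matrices\<close>

lemma inv_mat_invertible:
  assumes A: "A \<in> carrier_mat n n" and inv: "invertible_mat A"
  shows "inv_mat A \<in> carrier_mat n n" "A * inv_mat A = 1\<^sub>m n" "inv_mat A * A = 1\<^sub>m n"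
proof -
  obtain B where B: "A * B = 1\<^sub>m n" "B * A = 1\<^sub>m (dim_row B)"
    using inv A unfolding invertible_mat_def inverts_mat_def by auto
  have "dim_col (A * B) = n" "dim_col (B * A) = dim_row B" using B by simp_all
  then have "B \<in> carrier_mat n n" using A by (auto intro!: carrier_matI)
  then have "A \<in> Units (ring_mat TYPE(real) n undefined)"
    using A B by (auto simp: Units_def ring_mat_def)
  then obtain C where "mat_inverse A = Some C"
    using mat_inverse(1)[OF A] by fastforce
  then show "inv_mat A \<in> carrier_mat n n" "A * inv_mat A = 1\<^sub>m n" "inv_mat A * A = 1\<^sub>m n"
    using mat_inverse(2)[OF A] by (auto simp: inv_mat_def)
qed

lemma invertible_mat_if_trivial_kernel:
  fixes A :: "real mat"
  assumes A: "A \<in> carrier_mat n n"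
    and ker: "\<And>x. x \<in> carrier_vec n \<Longrightarrow> A *\<^sub>v x = 0\<^sub>v n \<Longrightarrow> x = 0\<^sub>v n"
  shows "invertible_mat A"
proof -
  have "det A \<noteq> 0" using ker det_0_iff_vec_prod_zero_field[OF A] by blast
  then show ?thesis using A det_non_zero_imp_unit[OF A]
    by (auto simp: Units_def ring_mat_def invertible_mat_def inverts_mat_def)
qed

lemma Diag_mult_vec:
  assumes "z \<in> carrier_vec n" "x \<in> carrier_vec n"
  shows "Diag z *\<^sub>v x = vec n (\<lambda>i. z $ i * x $ i)"
proof (rule eq_vecI)
  fix i assume "i < dim_vec (vec n (\<lambda>i. z $ i * x $ i))"
  then have i: "i < n" by simp
  have "(Diag z *\<^sub>v x) $ i = (\<Sum>j\<in>{0..<n}. (if i = j then z $ j else 0) * x $ j)"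
    using assms i by (simp add: Diag_def mat_diag_def scalar_prod_def)
  also have "\<dots> = (\<Sum>j\<in>{0..<n}. if j = i then z $ i * x $ i else 0)"
    by (rule sum.cong) auto
  finally have "(Diag z *\<^sub>v x) $ i = \<dots>" .
  then show "(Diag z *\<^sub>v x) $ i = vec n (\<lambda>i. z $ i * x $ i) $ i" using i by simp
qed (use assms in \<open>auto simp: Diag_def mat_diag_def\<close>)

lemma Diag_carrier: "z \<in> carrier_vec n \<Longrightarrow> Diag z \<in> carrier_mat n n"
  by (auto simp: Diag_def)

lemma abs_vec_carrier: "x \<in> carrier_vec n \<Longrightarrow> abs_vec x \<in> carrier_vec n"
  by (auto simp: abs_vec_def)

lemma flip_sign_vecs: "z \<in> sign_vecs n \<Longrightarrow> flip V z \<in> sign_vecs n"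
  by (fastforce simp: sign_vecs_def flip_def)

section \<open>Linear convergence in a weighted norm\<close>

text \<open>The hypothesis \<open>col\<close> says that R has norm at most s in the matrix norm
  induced by the w-weighted 1-norm. Q does not appear, so that both the resolvent weights and w = 1
  fit in. Weights are at least 1 so that no entry counts for less than its absolute value.\<close>

locale weighted_ave =
  fixes n :: nat and A R :: "real mat" and b :: "real vec" and w :: "nat \<Rightarrow> real" and s :: real
  assumes A: "A \<in> carrier_mat n n" and R: "R \<in> carrier_mat n n" and b: "b \<in> carrier_vec n"
    and AR: "A * R = 1\<^sub>m n" and RA: "R * A = 1\<^sub>m n"
    and w: "\<And>i. i < n \<Longrightarrow> 1 \<le> w i"
    and col: "\<And>j. j < n \<Longrightarrow> (\<Sum>i<n. w i * \<bar>R $$ (i, j)\<bar>) \<le> s * w j"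
    and s: "0 \<le> s" "s < 1 / 2"
begin

definition wnorm :: "real vec \<Rightarrow> real" where
  "wnorm x = (\<Sum>i<n. w i * \<bar>x $ i\<bar>)"

text \<open>This is y = Z x. For a sign vector its negative entries sit exactly at the mismatched
  indices; without any, y = |x|.\<close>

definition signed :: "real vec \<Rightarrow> real vec" where
  "signed z = vec n (\<lambda>i. z $ i * gnm_point A b z $ i)"

text \<open>Entries enter with their signs, so for a sign vector the sum equals the weighted norm of
  the point exactly when no index is mismatched.\<close>

definition potential :: "real vec \<Rightarrow> real" where
  "potential z = (\<Sum>i<n. w i * signed z $ i)"

definition neg_part :: "real vec \<Rightarrow> real" where
  "neg_part z = (\<Sum>i<n. w i * max 0 (- (signed z $ i)))"

lemma w0: "i < n \<Longrightarrow> 0 \<le> w i"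
  using w[of i] by simp

lemma wnorm_nonneg: "0 \<le> wnorm x"
  unfolding wnorm_def by (intro sum_nonneg mult_nonneg_nonneg) (auto simp: w0)

lemma wnorm_mult:
  assumes t: "t \<in> carrier_vec n"
  shows "wnorm (R *\<^sub>v t) \<le> s * wnorm t"
proof -
  have "wnorm (R *\<^sub>v t) = (\<Sum>i<n. w i * \<bar>\<Sum>j<n. R $$ (i, j) * t $ j\<bar>)"
    unfolding wnorm_def using R t by (auto simp: scalar_prod_def atLeast0LessThan intro!: sum.cong)
  also have "\<dots> \<le> (\<Sum>i<n. w i * (\<Sum>j<n. \<bar>R $$ (i, j)\<bar> * \<bar>t $ j\<bar>))"
    by (intro sum_mono mult_left_mono order.trans[OF sum_abs]) (auto simp: abs_mult w0)
  also have "\<dots> = (\<Sum>i<n. \<Sum>j<n. (w i * \<bar>R $$ (i, j)\<bar>) * \<bar>t $ j\<bar>)"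
    by (simp add: sum_distrib_left mult_ac)
  also have "\<dots> = (\<Sum>j<n. (\<Sum>i<n. w i * \<bar>R $$ (i, j)\<bar>) * \<bar>t $ j\<bar>)"
    by (subst sum.swap) (simp add: sum_distrib_right)
  also have "\<dots> \<le> (\<Sum>j<n. (s * w j) * \<bar>t $ j\<bar>)"
    by (intro sum_mono mult_right_mono col) auto
  also have "\<dots> = s * wnorm t" unfolding wnorm_def by (simp add: sum_distrib_left mult_ac)
  finally show ?thesis .
qed

lemma wnorm_eq_0:
  assumes "x \<in> carrier_vec n" "wnorm x = 0"
  shows "x = 0\<^sub>v n"
proof -
  have "\<forall>i\<in>{..<n}. w i * \<bar>x $ i\<bar> = 0"
    using assms(2) unfolding wnorm_def
    by (subst (asm) sum_nonneg_eq_0_iff) (auto simp: w0)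
  then have "x $ i = 0" if "i < n" for i using w[OF that] that by force
  then show ?thesis using assms(1) by (intro eq_vecI) auto
qed

text \<open>The norm of x is at most s times that of t, hence at most s times itself. With t = Z x
  this gives nonsingularity of A - Z; applied to the difference of two solutions it gives
  uniqueness.\<close>

lemma contraction_eq_0:
  assumes x: "x \<in> carrier_vec n" and t: "t \<in> carrier_vec n"
    and eq: "x = R *\<^sub>v t" and le: "\<And>i. i < n \<Longrightarrow> \<bar>t $ i\<bar> \<le> \<bar>x $ i\<bar>"
  shows "x = 0\<^sub>v n"
proof (rule wnorm_eq_0[OF x])
  have "wnorm t \<le> wnorm x" unfolding wnorm_def
    by (intro sum_mono mult_left_mono) (auto simp: w0 le)
  then have "s * wnorm t \<le> s * wnorm x" using s by (intro mult_left_mono) auto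
  then have "wnorm x \<le> s * wnorm x" using wnorm_mult[OF t] eq by simp
  then have "(1 - s) * wnorm x \<le> 0" by (simp add: algebra_simps)
  then show "wnorm x = 0" using s wnorm_nonneg[of x] by (simp add: mult_le_0_iff)
qed

section \<open>Fixed-point forms of the equation and of the computed points\<close>

lemma A_eq_iff:
  assumes "x \<in> carrier_vec n" "t \<in> carrier_vec n"
  shows "A *\<^sub>v x = t \<longleftrightarrow> x = R *\<^sub>v t"
proof
  assume "A *\<^sub>v x = t"
  then have "R *\<^sub>v t = (R * A) *\<^sub>v x" using assms A R by simp
  then show "x = R *\<^sub>v t" using RA assms by simp
next
  assume "x = R *\<^sub>v t"
  then have "A *\<^sub>v x = (A * R) *\<^sub>v t" using assms A R by simp
  then show "A *\<^sub>v x = t" using AR assms by simp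
qed

text \<open>A kernel vector satisfies x = R (Z x), and |Z x| = |x| since the entries of z are
  signs.\<close>

lemma invertible_shifted:
  assumes z: "z \<in> sign_vecs n"
  shows "invertible_mat (A - Diag z)"
proof (rule invertible_mat_if_trivial_kernel)
  have zc: "z \<in> carrier_vec n" using z by (simp add: sign_vecs_def)
  note D = Diag_carrier[OF zc]
  show "A - Diag z \<in> carrier_mat n n" using D by (rule minus_carrier_mat)
  fix x assume x: "x \<in> carrier_vec n" "(A - Diag z) *\<^sub>v x = 0\<^sub>v n"
  have "A *\<^sub>v x - Diag z *\<^sub>v x = 0\<^sub>v n"
    using x minus_mult_distrib_mat_vec[OF A D x(1)] by simp
  then have "A *\<^sub>v x = Diag z *\<^sub>v x"
    using A D x(1) by (auto simp: vec_eq_iff)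
  then have eq: "x = R *\<^sub>v (Diag z *\<^sub>v x)"
    using A_eq_iff[OF x(1) mult_mat_vec_carrier[OF D x(1)]] by simp
  have "\<bar>z $ i\<bar> = 1" if "i < n" for i using z that by (auto simp: sign_vecs_def)
  then show "x = 0\<^sub>v n"
    by (intro contraction_eq_0[OF x(1) _ eq]) (use D x in \<open>auto simp: Diag_mult_vec[OF zc x(1)] abs_mult\<close>)
qed

lemma gnm_point_carrier:
  assumes z: "z \<in> sign_vecs n"
  shows "gnm_point A b z \<in> carrier_vec n"
proof -
  have zc: "z \<in> carrier_vec n" using z by (simp add: sign_vecs_def)
  have "A - Diag z \<in> carrier_mat n n" using Diag_carrier[OF zc] by (rule minus_carrier_mat)
  from inv_mat_invertible(1)[OF this invertible_shifted[OF z]] show ?thesis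
    unfolding gnm_point_def by (rule mult_mat_vec_carrier[OF _ b])
qed

text \<open>The second form x = R (t + b) with t = Z x is that of a solution with t = |x| instead;
  differences of any two such points are then covered by one estimate in which b cancels.\<close>

lemma gnm_point_eq:
  assumes z: "z \<in> sign_vecs n"
  shows "(A - Diag z) *\<^sub>v gnm_point A b z = b" "gnm_point A b z = R *\<^sub>v (signed z + b)"
proof -
  let ?x = "gnm_point A b z"
  have zc: "z \<in> carrier_vec n" using z by (simp add: sign_vecs_def)
  note D = Diag_carrier[OF zc]
  have AD: "A - Diag z \<in> carrier_mat n n" using D by (rule minus_carrier_mat)
  note I = inv_mat_invertible[OF AD invertible_shifted[OF z]]
  have x: "?x \<in> carrier_vec n" by (rule gnm_point_carrier[OF z])
  have "(A - Diag z) *\<^sub>v ?x = ((A - Diag z) * inv_mat (A - Diag z)) *\<^sub>v b"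
    unfolding gnm_point_def by (rule assoc_mult_mat_vec[OF AD I(1) b, symmetric])
  then show eq: "(A - Diag z) *\<^sub>v ?x = b" using I b by simp
  have "A *\<^sub>v ?x - Diag z *\<^sub>v ?x = b"
    using eq minus_mult_distrib_mat_vec[OF A D x] by simp
  then have "A *\<^sub>v ?x = signed z + b"
    using A D x b unfolding signed_def Diag_mult_vec[OF zc x]
    by (auto simp: vec_eq_iff algebra_simps)
  then show "?x = R *\<^sub>v (signed z + b)"
    using A_eq_iff[OF x, of "signed z + b"] b by (simp add: signed_def)
qed

lemma ave_solution_iff:
  "ave_solution n A b x \<longleftrightarrow> x \<in> carrier_vec n \<and> x = R *\<^sub>v (abs_vec x + b)"
proof (cases "x \<in> carrier_vec n")
  case x: True
  note ax = abs_vec_carrier[OF x]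
  have "A *\<^sub>v x - abs_vec x = b \<longleftrightarrow> A *\<^sub>v x = abs_vec x + b"
    using x A b ax by (auto simp: vec_eq_iff algebra_simps)
  then show ?thesis using A_eq_iff[OF x, of "abs_vec x + b"] x ax b
    by (auto simp: ave_solution_def)
qed (auto simp: ave_solution_def)

lemma wnorm_diff:
  assumes "t \<in> carrier_vec n" "t' \<in> carrier_vec n" "x = R *\<^sub>v (t + b)" "x' = R *\<^sub>v (t' + b)"
  shows "wnorm (x - x') \<le> s * wnorm (t - t')" "x - x' = R *\<^sub>v (t - t')"
proof -
  have "x - x' = R *\<^sub>v ((t + b) - (t' + b))"
    using assms R b by (simp add: mult_minus_distrib_mat_vec)
  also have "(t + b) - (t' + b) = t - t'" using assms b by (auto simp: vec_eq_iff)
  finally show eq: "x - x' = R *\<^sub>v (t - t')" .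
  show "wnorm (x - x') \<le> s * wnorm (t - t')" unfolding eq
    by (rule wnorm_mult) (use assms in auto)
qed

lemma ave_solution_unique:
  assumes "ave_solution n A b x" "ave_solution n A b y"
  shows "y = x"
proof -
  have x: "x \<in> carrier_vec n" "x = R *\<^sub>v (abs_vec x + b)"
    and y: "y \<in> carrier_vec n" "y = R *\<^sub>v (abs_vec y + b)"
    using assms ave_solution_iff by auto
  note ax = abs_vec_carrier[OF x(1)] and ay = abs_vec_carrier[OF y(1)]
  have "y - x = 0\<^sub>v n"
    by (rule contraction_eq_0[OF _ _ wnorm_diff(2)[OF ay ax y(2) x(2)]])
      (use x(1) y(1) ax ay in \<open>auto simp: abs_vec_def\<close>)
  then show ?thesis using x(1) y(1) by (auto simp: vec_eq_iff)
qed

section \<open>Effect of one full flip on the potential\<close>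

lemma abs_signed:
  assumes "z \<in> sign_vecs n" "i < n"
  shows "\<bar>signed z $ i\<bar> = \<bar>gnm_point A b z $ i\<bar>"
  using assms by (auto simp: sign_vecs_def signed_def)

lemma mismatch_iff:
  assumes "z \<in> sign_vecs n" "i < n"
  shows "i \<in> mismatch A b z \<longleftrightarrow> signed z $ i < 0"
  using assms by (auto simp: sign_vecs_def signed_def mismatch_def)

text \<open>Let d be the weighted norm of y' - |y| and N the negative part of y. Contraction gives d
  <= s (d + 2 N), while the potential grows by at least 2 N - d. Eliminating d leaves a gain that is
  a positive multiple of N because s < 1/2.\<close>

lemma potential_flip:
  assumes z: "z \<in> sign_vecs n"
  defines "z' \<equiv> flip (mismatch A b z) z"
  shows "2 * (1 - 2 * s) * neg_part z \<le> (1 - s) * (potential z' - potential z)"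
proof -
  have z': "z' \<in> sign_vecs n" unfolding z'_def by (rule flip_sign_vecs[OF z])
  let ?x = "gnm_point A b z" and ?x' = "gnm_point A b z'"
  let ?y = "signed z" and ?y' = "signed z'"
  define d where "d = (\<Sum>i<n. w i * \<bar>?y' $ i - \<bar>?y $ i\<bar>\<bar>)"
  have yc: "?y \<in> carrier_vec n" "?y' \<in> carrier_vec n" by (auto simp: signed_def)
  \<comment> \<open>The flip makes z'_i x_i = |y_i|, so y'_i - |y_i| = z'_i (x'_i - x_i). That this
    holds at every i relies on flipping all mismatched indices at once.\<close>
  have "\<bar>(?x' - ?x) $ i\<bar> = \<bar>?y' $ i - \<bar>?y $ i\<bar>\<bar>" if i: "i < n" for i
  proof -
    have dim: "dim_vec z = n" "z $ i \<in> {-1, 1}" using z i by (auto simp: sign_vecs_def)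
    have z'i: "z' $ i = (if ?y $ i < 0 then - z $ i else z $ i)"
      using i dim mismatch_iff[OF z i] by (simp add: z'_def flip_def)
    have "?y $ i = z $ i * ?x $ i" "?y' $ i = z' $ i * ?x' $ i" using i by (auto simp: signed_def)
    then show ?thesis using dim z'i i gnm_point_carrier[OF z] by auto
  qed
  then have "wnorm (?x' - ?x) = d" unfolding wnorm_def d_def by (intro sum.cong) auto
  then have "d \<le> s * wnorm (?y' - ?y)"
    using wnorm_diff(1)[OF yc(2,1) gnm_point_eq(2)[OF z'] gnm_point_eq(2)[OF z]] by simp
  \<comment> \<open>Triangle inequality through |y|, where |y| - y is twice the negative part of
    y.\<close>
  moreover have "wnorm (?y' - ?y) \<le> (\<Sum>i<n. w i * (\<bar>?y' $ i - \<bar>?y $ i\<bar>\<bar> + 2 * max 0 (- (?y $ i))))"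
    unfolding wnorm_def by (intro sum_mono mult_left_mono) (use yc in \<open>auto simp: w0\<close>)
  then have "wnorm (?y' - ?y) \<le> d + 2 * neg_part z"
    by (simp add: d_def neg_part_def sum.distrib sum_distrib_left algebra_simps)
  then have "s * wnorm (?y' - ?y) \<le> s * (d + 2 * neg_part z)" using s by (intro mult_left_mono) auto
  ultimately have d: "(1 - s) * d \<le> 2 * s * neg_part z" by (simp add: algebra_simps)
  \<comment> \<open>Each factor after w_i is |y_i| - |y'_i - |y_i||, hence at most y'_i.\<close>
  have "potential z + 2 * neg_part z - d =
      (\<Sum>i<n. w i * (?y $ i + 2 * max 0 (- (?y $ i)) - \<bar>?y' $ i - \<bar>?y $ i\<bar>\<bar>))"
    by (simp add: d_def neg_part_def potential_def sum.distrib sum_subtractf sum_distrib_left algebra_simps)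
  also have "\<dots> \<le> potential z'" unfolding potential_def
    by (intro sum_mono mult_left_mono) (auto simp: w0)
  finally have "(1 - s) * (potential z + 2 * neg_part z - d) \<le> (1 - s) * potential z'"
    using s by (intro mult_left_mono) auto
  then show ?thesis using d by (simp add: algebra_simps)
qed

text \<open>Since |y| = |p|, each entry of |x| - y is bounded by |x - p| plus twice the negative
  part of y. By contraction the first term has norm at most s times that of |x| - y and is
  absorbed.\<close>

lemma gap_le_neg_part:
  assumes z: "z \<in> sign_vecs n" and sol: "ave_solution n A b x"
  shows "(1 - s) * (wnorm x - potential z) \<le> 2 * neg_part z"
proof -
  let ?p = "gnm_point A b z" and ?y = "signed z"
  have x: "x \<in> carrier_vec n" "x = R *\<^sub>v (abs_vec x + b)" using sol ave_solution_iff by auto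
  have yc: "?y \<in> carrier_vec n" by (auto simp: signed_def)
  note p = gnm_point_carrier[OF z] and ax = abs_vec_carrier[OF x(1)]
  have le: "\<bar>(abs_vec x - ?y) $ i\<bar> \<le> \<bar>(x - ?p) $ i\<bar> + 2 * max 0 (- (?y $ i))" if i: "i < n" for i
    using abs_signed[OF z i] i x(1) p yc by (auto simp: abs_vec_def)
  have "wnorm (abs_vec x - ?y) \<le> (\<Sum>i<n. w i * (\<bar>(x - ?p) $ i\<bar> + 2 * max 0 (- (?y $ i))))"
    unfolding wnorm_def by (intro sum_mono mult_left_mono le) (auto simp: w0)
  also have "\<dots> = wnorm (x - ?p) + 2 * neg_part z"
    by (simp add: wnorm_def neg_part_def sum.distrib sum_distrib_left algebra_simps)
  also have "\<dots> \<le> s * wnorm (abs_vec x - ?y) + 2 * neg_part z"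
    using wnorm_diff(1)[OF ax yc x(2) gnm_point_eq(2)[OF z]] by simp
  finally have 1: "(1 - s) * wnorm (abs_vec x - ?y) \<le> 2 * neg_part z" by (simp add: algebra_simps)
  have "wnorm x - potential z = (\<Sum>i<n. w i * (\<bar>x $ i\<bar> - ?y $ i))"
    by (simp add: wnorm_def potential_def sum_subtractf algebra_simps)
  also have "\<dots> \<le> wnorm (abs_vec x - ?y)" unfolding wnorm_def
    by (intro sum_mono mult_left_mono) (use x(1) yc in \<open>auto simp: w0 abs_vec_def\<close>)
  finally have "(1 - s) * (wnorm x - potential z) \<le> (1 - s) * wnorm (abs_vec x - ?y)"
    using s by (intro mult_left_mono) auto
  then show ?thesis using 1 by linarith
qed

text \<open>The negative part bounds the gap from above and the gain of a flip from below, up to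
  constants; so a flip closes at least the fraction 1 - 2 s of the gap.\<close>

lemma gap_flip:
  assumes z: "z \<in> sign_vecs n" and sol: "ave_solution n A b x"
  shows "wnorm x - potential (flip (mismatch A b z) z) \<le> 2 * s * (wnorm x - potential z)"
proof -
  let ?P = "potential z" and ?P' = "potential (flip (mismatch A b z) z)"
  have "(1 - 2 * s) * ((1 - s) * (wnorm x - ?P)) \<le> (1 - 2 * s) * (2 * neg_part z)"
    using gap_le_neg_part[OF z sol] s by (intro mult_left_mono) auto
  also have "\<dots> \<le> (1 - s) * (?P' - ?P)" using potential_flip[OF z] by (simp add: algebra_simps)
  finally have "(1 - s) * ((1 - 2 * s) * (wnorm x - ?P)) \<le> (1 - s) * (?P' - ?P)"
    by (simp add: mult_ac)
  then have "(1 - 2 * s) * (wnorm x - ?P) \<le> ?P' - ?P" using s by (simp add: mult_le_cancel_left)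
  then show ?thesis by (simp add: algebra_simps)
qed

lemma final_point:
  assumes z: "z \<in> sign_vecs n" and mm: "mismatch A b z = {}"
  shows "ave_solution n A b (gnm_point A b z)" "wnorm (gnm_point A b z) = potential z"
proof -
  let ?x = "gnm_point A b z"
  note p = gnm_point_carrier[OF z]
  have y: "signed z $ i = \<bar>?x $ i\<bar>" if i: "i < n" for i
    using mm mismatch_iff[OF z i] abs_signed[OF z i] by auto
  then have "signed z = abs_vec ?x" using p by (intro eq_vecI) (auto simp: signed_def abs_vec_def)
  then show "ave_solution n A b ?x" using gnm_point_eq(2)[OF z] p ave_solution_iff by simp
  show "wnorm ?x = potential z" by (simp add: wnorm_def potential_def y)
qed

section \<open>Termination and length of runs\<close>

lemma gnm_run_final:
  assumes "gnm_run A b z k x" "z \<in> sign_vecs n"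
  shows "\<exists>z' \<in> sign_vecs n. mismatch A b z' = {} \<and> x = gnm_point A b z'"
  using assms by induction (auto intro: flip_sign_vecs)

lemma gnm_run_solution:
  assumes "gnm_run A b z k x" "z \<in> sign_vecs n"
  shows "ave_solution n A b x"
  using gnm_run_final[OF assms] final_point(1) by auto

text \<open>A mismatched index has a nonzero entry and contributes at least \<eta> on its own, the
  weights being at least 1.\<close>

lemma neg_part_ge:
  assumes z: "z \<in> sign_vecs n" and mm: "mismatch A b z \<noteq> {}"
    and \<eta>: "\<And>z i. z \<in> sign_vecs n \<Longrightarrow> i < n \<Longrightarrow> gnm_point A b z $ i \<noteq> 0 \<Longrightarrow> \<eta> \<le> \<bar>gnm_point A b z $ i\<bar>"
  shows "\<eta> \<le> neg_part z"
proof -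
  obtain i where i: "i \<in> mismatch A b z" using mm by auto
  then have "i < n" using z by (auto simp: mismatch_def sign_vecs_def)
  then have y: "signed z $ i < 0" using i mismatch_iff[OF z] by simp
  then have "\<eta> \<le> - (signed z $ i)" using \<eta>[OF z \<open>i < n\<close>] abs_signed[OF z \<open>i < n\<close>] by fastforce
  also have "\<dots> \<le> w i * max 0 (- (signed z $ i))"
    using y w[OF \<open>i < n\<close>] mult_right_mono[of 1 "w i" "- (signed z $ i)"] by simp
  also have "\<dots> \<le> neg_part z" unfolding neg_part_def
    by (rule member_le_sum) (use \<open>i < n\<close> in \<open>auto simp: w0\<close>)
  finally show ?thesis .
qed

text \<open>The potential is bounded on the sign vectors and every pass raises it by a fixed amount.
  The geometric decay of the gap would presuppose a solution, whose existence is itself obtained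
  from a terminating run.\<close>

lemma gnm_run_exists:
  assumes z: "z \<in> sign_vecs n" and "0 < \<eta>"
    and \<eta>: "\<And>z i. z \<in> sign_vecs n \<Longrightarrow> i < n \<Longrightarrow> gnm_point A b z $ i \<noteq> 0 \<Longrightarrow> \<eta> \<le> \<bar>gnm_point A b z $ i\<bar>"
    and E: "\<And>z i. z \<in> sign_vecs n \<Longrightarrow> i < n \<Longrightarrow> \<bar>gnm_point A b z $ i\<bar> \<le> E"
  shows "\<exists>k x. gnm_run A b z k x"
proof -
  define U where "U = (\<Sum>i<n. w i * E)"
  define \<epsilon> where "\<epsilon> = 2 * (1 - 2 * s) * \<eta> / (1 - s)"
  have \<epsilon>: "0 < \<epsilon>" using s \<open>0 < \<eta>\<close> by (simp add: \<epsilon>_def)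
  have U: "potential z \<le> U" if "z \<in> sign_vecs n" for z
    unfolding U_def potential_def
    by (intro sum_mono mult_left_mono) (use that E abs_signed in \<open>fastforce simp: w0\<close>)+
  have step: "potential z + \<epsilon> \<le> potential (flip (mismatch A b z) z)"
    if z: "z \<in> sign_vecs n" "mismatch A b z \<noteq> {}" for z
  proof -
    have "2 * (1 - 2 * s) * \<eta> \<le> 2 * (1 - 2 * s) * neg_part z"
      using neg_part_ge[OF z \<eta>] s by (intro mult_left_mono) auto
    then have "2 * (1 - 2 * s) * \<eta> \<le> (1 - s) * (potential (flip (mismatch A b z) z) - potential z)"
      using potential_flip[OF z(1)] by linarith
    then have "\<epsilon> \<le> potential (flip (mismatch A b z) z) - potential z"
      using s by (simp add: \<epsilon>_def pos_divide_le_eq mult.commute)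
    then show ?thesis by simp
  qed
  \<comment> \<open>Induction on a number m of increments that would carry the potential past its
    bound U; m = 0 is contradictory.\<close>
  have "\<exists>k x. gnm_run A b z k x" if "z \<in> sign_vecs n" "U < potential z + real m * \<epsilon>" for m z
    using that
  proof (induction m arbitrary: z)
    case 0
    then show ?case using U[of z] by simp
  next
    case (Suc m)
    show ?case
    proof (cases "mismatch A b z = {}")
      case True
      then show ?thesis by (blast intro: gnm_run.stop)
    next
      case False
      have "U < potential (flip (mismatch A b z) z) + real m * \<epsilon>"
        using step[OF Suc.prems(1) False] Suc.prems(2) by (simp add: algebra_simps)
      then show ?thesis using Suc.IH[OF flip_sign_vecs[OF Suc.prems(1)]] False
        by (blast intro: gnm_run.pass)
    qed
  qed
  moreover obtain m :: nat where "U - potential z < real m * \<epsilon>"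
    using reals_Archimedean3[OF \<epsilon>] by blast
  ultimately show ?thesis using z by (simp add: algebra_simps)
qed

text \<open>Before the last pass some index is still mismatched, so that pass alone gains at least 2
  (1 - 2 s) \<eta>. The k - 1 passes before it each shrink the gap by the factor 2 s, hence the
  exponent.\<close>

lemma gnm_run_gap:
  assumes "gnm_run A b z k x" "z \<in> sign_vecs n"
    and \<eta>: "\<And>z i. z \<in> sign_vecs n \<Longrightarrow> i < n \<Longrightarrow> gnm_point A b z $ i \<noteq> 0 \<Longrightarrow> \<eta> \<le> \<bar>gnm_point A b z $ i\<bar>"
  shows "0 \<le> wnorm x - potential z \<and>
    (0 < k \<longrightarrow> 2 * (1 - 2 * s) * \<eta> \<le> (2 * s) ^ (k - 1) * (wnorm x - potential z))"
  using assms(1,2)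
proof induction
  case (stop z)
  then show ?case using final_point(2) by simp
next
  case (pass z k x)
  let ?z' = "flip (mismatch A b z) z"
  have z': "?z' \<in> sign_vecs n" using pass.prems by (rule flip_sign_vecs)
  note IH = pass.IH[OF z']
  have sol: "ave_solution n A b x" by (rule gnm_run_solution[OF pass.hyps(2) z'])
  define e where "e = 2 * (1 - 2 * s) * neg_part z"
  have N0: "0 \<le> neg_part z" unfolding neg_part_def by (intro sum_nonneg) (auto simp: w0)
  then have e0: "0 \<le> e" unfolding e_def using s by simp
  have e: "e \<le> (1 - s) * (potential ?z' - potential z)"
    unfolding e_def by (rule potential_flip[OF pass.prems])
  then have "0 \<le> (1 - s) * (potential ?z' - potential z)" using e0 by linarith
  then have P: "potential z \<le> potential ?z'" using s by (simp add: zero_le_mult_iff)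
  then have "(1 - s) * (potential ?z' - potential z) \<le> 1 * (potential ?z' - potential z)"
    using s by (intro mult_right_mono) auto
  then have eP: "e \<le> potential ?z' - potential z" using e by simp
  have \<eta>N: "\<eta> \<le> neg_part z" by (rule neg_part_ge[OF pass.prems pass.hyps(1) \<eta>])
  have "2 * (1 - 2 * s) * \<eta> \<le> e" unfolding e_def using \<eta>N s by (intro mult_left_mono) auto
  then have 1: "2 * (1 - 2 * s) * \<eta> \<le> wnorm x - potential z" using eP IH by linarith
  have 2: "2 * (1 - 2 * s) * \<eta> \<le> (2 * s) ^ k * (wnorm x - potential z)" if "0 < k"
  proof -
    have "2 * (1 - 2 * s) * \<eta> \<le> (2 * s) ^ (k - 1) * (wnorm x - potential ?z')" using IH that by simp
    also have "\<dots> \<le> (2 * s) ^ (k - 1) * (2 * s * (wnorm x - potential z))"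
      using gap_flip[OF pass.prems sol] s by (intro mult_left_mono) auto
    also have "\<dots> = (2 * s) ^ k * (wnorm x - potential z)" using that by (cases k) auto
    finally show ?thesis .
  qed
  \<comment> \<open>The run from z has k + 1 passes, so the exponent is k. For k = 0 the pass is the
    last one and the first bound applies, otherwise the second.\<close>
  show ?case using 1 2 IH P by (cases "k = 0") auto
qed

end

section \<open>Determinantal bounds and resolvent weights\<close>

text \<open>Leibniz formula with its n! terms. This is cruder than Hadamard's inequality, but only
  logarithms of such bounds enter the iteration count.\<close>

lemma det_abs_le:
  fixes A :: "'a :: linordered_idom mat"
  assumes A: "A \<in> carrier_mat n n" and B: "\<And>i j. i < n \<Longrightarrow> j < n \<Longrightarrow> \<bar>A $$ (i, j)\<bar> \<le> B"
  shows "\<bar>det A\<bar> \<le> fact n * B ^ n"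
proof -
  have "\<bar>det A\<bar> \<le> (\<Sum>p | p permutes {0..<n}. \<bar>signof p * (\<Prod>i = 0..<n. A $$ (i, p i))\<bar>)"
    unfolding det_def'[OF A] by (rule sum_abs)
  also have "\<dots> \<le> (\<Sum>p | p permutes {0..<n}. B ^ n)"
  proof (rule sum_mono)
    fix p assume p: "p \<in> {p. p permutes {0..<n}}"
    have "\<bar>signof p :: 'a\<bar> = 1" using signof_pm_one[of p, where 'a = 'a] by auto
    then have "\<bar>signof p * (\<Prod>i = 0..<n. A $$ (i, p i))\<bar> = (\<Prod>i = 0..<n. \<bar>A $$ (i, p i)\<bar>)"
      by (simp add: abs_mult abs_prod)
    also have "\<dots> \<le> (\<Prod>i = 0..<n. B)"
      using p by (intro prod_mono) (auto intro!: B simp: permutes_in_image[of p "{0..<n}", simplified])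
    finally show "\<bar>signof p * (\<Prod>i = 0..<n. A $$ (i, p i))\<bar> \<le> B ^ n" by simp
  qed
  also have "\<dots> = fact n * B ^ n" using card_permutations[of "{0..<n}" n] by simp
  finally show ?thesis .
qed

lemma adj_mat_abs_le:
  fixes A :: "'a :: linordered_idom mat"
  assumes A: "A \<in> carrier_mat n n" and B: "\<And>i j. i < n \<Longrightarrow> j < n \<Longrightarrow> \<bar>A $$ (i, j)\<bar> \<le> B"
    and ij: "i < n" "j < n"
  shows "\<bar>adj_mat A $$ (i, j)\<bar> \<le> fact (n - 1) * B ^ (n - 1)"
proof -
  have "\<bar>mat_delete A j i $$ (i', j')\<bar> \<le> B" if "i' < n - 1" "j' < n - 1" for i' j'
    using A ij that by (auto simp: mat_delete_def intro!: B)
  then have "\<bar>det (mat_delete A j i)\<bar> \<le> fact (n - 1) * B ^ (n - 1)"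
    by (rule det_abs_le[OF mat_delete_carrier[OF A]])
  then show ?thesis using A ij by (simp add: adj_mat_def cofactor_def abs_mult power_abs)
qed

text \<open>By Cramer's rule the solution is an integral vector divided by \<open>det N\<close>.\<close>

lemma integral_system_bounds:
  fixes N :: "int mat" and c :: "int vec" and y :: "real vec"
  assumes N: "N \<in> carrier_mat n n" and c: "c \<in> carrier_vec n" and y: "y \<in> carrier_vec n"
    and det: "det N \<noteq> 0"
    and eq: "map_mat real_of_int N *\<^sub>v y = map_vec real_of_int c"
    and B: "\<And>i j. i < n \<Longrightarrow> j < n \<Longrightarrow> \<bar>N $$ (i, j)\<bar> \<le> B"
    and B': "\<And>i. i < n \<Longrightarrow> \<bar>c $ i\<bar> \<le> B'"
    and i: "i < n"
  shows "\<bar>y $ i\<bar> \<le> fact n * real_of_int B ^ (n - 1) * real_of_int B'"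
    and "y $ i \<noteq> 0 \<Longrightarrow> 1 \<le> \<bar>y $ i\<bar> * (fact n * real_of_int B ^ n)"
proof -
  let ?N = "map_mat real_of_int N" and ?a = "map_mat real_of_int (adj_mat N)"
  note adj = adj_mat[OF N]
  \<comment> \<open>The integral numerator in Cramer's rule, equal to \<open>det N\<close> times
    y_i.\<close>
  define g where "g = (adj_mat N *\<^sub>v c) $ i"
  have "?a * ?N = map_mat real_of_int (adj_mat N * N)"
    by (rule of_int_hom.mat_hom_mult[OF adj(1) N, symmetric])
  also have "\<dots> = real_of_int (det N) \<cdot>\<^sub>m 1\<^sub>m n" unfolding adj(3) by (auto simp: mat_eq_iff)
  finally have aN: "?a * ?N = real_of_int (det N) \<cdot>\<^sub>m 1\<^sub>m n" .
  have "real_of_int (det N) \<cdot>\<^sub>v y = (?a * ?N) *\<^sub>v y" unfolding aN using y by (auto simp: vec_eq_iff)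
  also have "\<dots> = ?a *\<^sub>v map_vec real_of_int c"
    using N adj(1) y eq by (subst assoc_mult_mat_vec[of _ n n _ n]) auto
  also have "\<dots> = map_vec real_of_int (adj_mat N *\<^sub>v c)"
    by (rule of_int_hom.mult_mat_vec_hom[OF adj(1) c, symmetric])
  finally have "(real_of_int (det N) \<cdot>\<^sub>v y) $ i = map_vec real_of_int (adj_mat N *\<^sub>v c) $ i" by simp
  then have g: "real_of_int (det N) * y $ i = real_of_int g"
    using i y N adj(1) by (simp add: g_def)
  then have g': "\<bar>real_of_int (det N)\<bar> * \<bar>y $ i\<bar> = real_of_int \<bar>g\<bar>" by (simp flip: abs_mult)
  have B0: "0 \<le> B" "0 \<le> B'" using B[OF i i] B'[OF i] by auto
  have "\<bar>g\<bar> = \<bar>\<Sum>j\<in>{0..<n}. adj_mat N $$ (i, j) * c $ j\<bar>"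
    using i adj(1) c by (simp add: g_def scalar_prod_def)
  also have "\<dots> \<le> (\<Sum>j\<in>{0..<n}. \<bar>adj_mat N $$ (i, j)\<bar> * \<bar>c $ j\<bar>)"
    by (rule order.trans[OF sum_abs]) (simp add: abs_mult)
  also have "\<dots> \<le> (\<Sum>j\<in>{0..<n}. (fact (n - 1) * B ^ (n - 1)) * B')"
    using adj_mat_abs_le[OF N B] i B' B0 by (intro sum_mono mult_mono) auto
  also have "\<dots> = fact n * B ^ (n - 1) * B'" using i by (simp add: fact_reduce[of n])
  finally have "real_of_int \<bar>g\<bar> \<le> real_of_int (fact n * B ^ (n - 1) * B')" by linarith
  then have G: "real_of_int \<bar>g\<bar> \<le> fact n * real_of_int B ^ (n - 1) * real_of_int B'" by simp
  \<comment> \<open>A nonzero integral determinant has absolute value at least 1, so |y_i| <=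
    |g|.\<close>
  have "1 * \<bar>y $ i\<bar> \<le> \<bar>real_of_int (det N)\<bar> * \<bar>y $ i\<bar>"
    using det by (intro mult_right_mono) linarith+
  then show "\<bar>y $ i\<bar> \<le> fact n * real_of_int B ^ (n - 1) * real_of_int B'" using g' G by linarith
  assume "y $ i \<noteq> 0"
  \<comment> \<open>A nonzero integer has absolute value at least 1, so |y_i| >= 1 / |det
    N|.\<close>
  then have "g \<noteq> 0" using g det by auto
  then have "1 \<le> \<bar>real_of_int (det N)\<bar> * \<bar>y $ i\<bar>" using g' by linarith
  also have "\<bar>det N\<bar> \<le> fact n * B ^ n" by (rule det_abs_le[OF N B])
  then have "real_of_int \<bar>det N\<bar> \<le> real_of_int (fact n * B ^ n)" by linarith
  then have "\<bar>real_of_int (det N)\<bar> * \<bar>y $ i\<bar> \<le> (fact n * real_of_int B ^ n) * \<bar>y $ i\<bar>"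
    by (intro mult_right_mono) auto
  finally show "1 \<le> \<bar>y $ i\<bar> * (fact n * real_of_int B ^ n)" by (simp add: mult.commute)
qed

section \<open>Spectral radius, resolvent determinant and decay of powers\<close>

lemma spectral_radius_ge:
  assumes "A \<in> carrier_mat n n" "poly (char_poly A) a = 0"
  shows "norm a \<le> spectral_radius A"
proof -
  have a: "a \<in> spectrum A" using assms spectrum_root_char_poly by blast
  then have "norm ` spectrum A \<noteq> {}" "finite (norm ` spectrum A)" using card_finite_spectrum[OF assms(1)] by auto
  then show ?thesis unfolding spectral_radius_def using a by simp
qed

text \<open>The determinant is the characteristic polynomial at s, that is, the product of s - a
  over the n complex eigenvalues a, and |s - a| >= s - |a| >= s - \<rho>.\<close>

lemma det_resolvent_ge:
  fixes B :: "real mat"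
  assumes B: "B \<in> carrier_mat n n" and sr: "real_spectral_radius B \<le> \<rho>" and s: "\<rho> \<le> s"
  shows "(s - \<rho>) ^ n \<le> \<bar>det (s \<cdot>\<^sub>m 1\<^sub>m n - B)\<bar>"
proof -
  let ?B = "map_mat complex_of_real B"
  have B': "?B \<in> carrier_mat n n" using B by simp
  obtain as where as: "char_poly ?B = (\<Prod>a\<leftarrow>as. [:- a, 1:])" "length as = n"
    using char_poly_factorized[OF B'] by blast
  have root: "norm a \<le> \<rho>" if "a \<in> set as" for a
  proof -
    have "poly (char_poly ?B) a = 0" unfolding as(1) by (rule linear_poly_root[OF that])
    then show ?thesis using spectral_radius_ge[OF B', of a] sr
      unfolding real_spectral_radius_def by linarith
  qed
  have "- char_matrix ?B (of_real s) = map_mat complex_of_real (s \<cdot>\<^sub>m 1\<^sub>m n - B)"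
    using B by (auto simp: char_matrix_def mat_eq_iff)
  then have "poly (char_poly ?B) (of_real s) = of_real (det (s \<cdot>\<^sub>m 1\<^sub>m n - B))"
    by (simp add: char_poly_matrix[OF B'])
  then have "\<bar>det (s \<cdot>\<^sub>m 1\<^sub>m n - B)\<bar> = norm (poly (char_poly ?B) (of_real s))" by simp
  also have "\<dots> = (\<Prod>a\<leftarrow>as. norm (of_real s - a))"
    unfolding as(1) by (induction as) (simp_all add: norm_mult flip: left_diff_distrib)
  also have "\<dots> \<ge> (\<Prod>a\<leftarrow>as. s - \<rho>)"
  proof -
    have le: "s - \<rho> \<le> norm (of_real s - a)" if "a \<in> set as" for a
      using root[OF that] norm_triangle_ineq2[of "of_real s" a] s by simp
    show ?thesis using le s
    proof (induction as)
      case (Cons a as)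
      then show ?case by (auto intro!: mult_mono prod_list_nonneg)
    qed simp
  qed
  finally show ?thesis using as(2) by (simp add: prod_list_replicate map_replicate_const)
qed

lemma pow_mat_smult:
  fixes A :: "'a :: comm_semiring_1 mat"
  assumes A: "A \<in> carrier_mat n n"
  shows "(c \<cdot>\<^sub>m A) ^\<^sub>m k = c ^ k \<cdot>\<^sub>m (A ^\<^sub>m k)"
proof (induction k)
  case 0
  then show ?case using A by (auto simp: mat_eq_iff)
next
  case (Suc k)
  have "(c \<cdot>\<^sub>m A) ^\<^sub>m Suc k = (c ^ k \<cdot>\<^sub>m (A ^\<^sub>m k)) * (c \<cdot>\<^sub>m A)" using Suc by simp
  also have "\<dots> = c ^ Suc k \<cdot>\<^sub>m (A ^\<^sub>m k * A)"
    using A pow_carrier_mat[OF A, of k]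
    by (auto simp: mat_eq_iff mult_smult_assoc_mat[of _ n n _ n] mult_smult_distrib[of _ n n _ n] mult_ac)
  finally show ?case by simp
qed

text \<open>B / t has spectral radius below 1, because t times an eigenvalue of it is an eigenvalue
  of B; so its powers are bounded.\<close>

lemma pow_mat_decay:
  fixes B :: "real mat"
  assumes B: "B \<in> carrier_mat n n" and n: "0 < n" and t: "real_spectral_radius B < t"
  shows "\<exists>c. \<forall>k. \<forall>i<n. \<forall>j<n. \<bar>(B ^\<^sub>m k) $$ (i, j)\<bar> \<le> c * t ^ k"
proof -
  let ?B = "map_mat complex_of_real B"
  let ?C = "complex_of_real (1 / t) \<cdot>\<^sub>m ?B"
  have B': "?B \<in> carrier_mat n n" and C: "?C \<in> carrier_mat n n" using B by auto
  obtain a where "a \<in> spectrum ?B" using spectrum_non_empty[OF B' n] by auto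
  then have "0 \<le> norm a" "norm a \<le> spectral_radius ?B"
    using spectral_radius_mem_max(2)[OF B' n] by auto
  then have t0: "0 < t" using t unfolding real_spectral_radius_def by linarith
  obtain e where e: "e \<in> spectrum ?C" "spectral_radius ?C = norm e"
    using spectral_radius_mem_max(1)[OF C n] by auto
  obtain v where "eigenvector ?C v e" using e(1) by (auto simp: spectrum_def eigenvalue_def)
  then have v: "v \<in> carrier_vec n" "v \<noteq> 0\<^sub>v n" "?C *\<^sub>v v = e \<cdot>\<^sub>v v"
    using C by (auto simp: eigenvector_def)
  have Cv: "?C *\<^sub>v v = complex_of_real (1 / t) \<cdot>\<^sub>v (?B *\<^sub>v v)"
    using B' v(1) by (auto simp: vec_eq_iff scalar_prod_def sum_distrib_left mult_ac)
  have "?B *\<^sub>v v = complex_of_real t \<cdot>\<^sub>v (?C *\<^sub>v v)"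
    unfolding Cv using t0 by (auto simp: vec_eq_iff)
  also have "\<dots> = (of_real t * e) \<cdot>\<^sub>v v" unfolding v(3) by (simp add: smult_smult_assoc)
  finally have "of_real t * e \<in> spectrum ?B"
    using v(1,2) B' by (auto simp: spectrum_def eigenvalue_def eigenvector_def)
  then have "norm (of_real t * e) \<le> spectral_radius ?B"
    using spectral_radius_mem_max(2)[OF B' n] by blast
  moreover have "norm (of_real t * e) = t * norm e" using t0 by (simp add: norm_mult)
  ultimately have "t * norm e < t * 1" using t unfolding real_spectral_radius_def by linarith
  then have "spectral_radius ?C < 1" using t0 unfolding e(2) by simp
  from spectral_radius_jnf_norm_bound_less_1_upper_triangular[OF C this]
  obtain c where c: "\<And>k. norm_bound (?C ^\<^sub>m k) c" by blast
  have "\<bar>(B ^\<^sub>m k) $$ (i, j)\<bar> \<le> c * t ^ k" if ij: "i < n" "j < n" for i j k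
  proof -
    have dims: "dim_row (?B ^\<^sub>m k) = n" "dim_col (?B ^\<^sub>m k) = n" "B ^\<^sub>m k \<in> carrier_mat n n"
      using pow_carrier_mat[OF B', of k] pow_carrier_mat[OF B, of k] by auto
    have "norm ((?C ^\<^sub>m k) $$ (i, j)) \<le> c"
      using c[of k, unfolded norm_bound_def carrier_matD[OF pow_carrier_mat[OF C, of k]]] ij by blast
    also have "(?C ^\<^sub>m k) $$ (i, j) = of_real ((1 / t) ^ k * (B ^\<^sub>m k) $$ (i, j))"
      unfolding pow_mat_smult[OF B'] using ij dims
      by (simp add: of_real_hom.mat_hom_pow[OF B, symmetric])
    finally show ?thesis using t0 by (simp add: norm_mult abs_mult power_divide norm_divide norm_power divide_simps)
  qed
  then show ?thesis by blast
qed

text \<open>The weights are the column sums of the inverse of \<open>s I - B\<close>; they are nonnegative because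
  \<open>w\<^sup>T B\<^sup>k \<le> s\<^sup>k w\<^sup>T\<close> while the powers of \<open>B / s\<close> tend to 0.\<close>

lemma nonneg_mat_weights:
  fixes B :: "real mat"
  assumes B: "B \<in> carrier_mat n n" and n: "0 < n"
    and B0: "\<And>i j. i < n \<Longrightarrow> j < n \<Longrightarrow> 0 \<le> B $$ (i, j)"
    and BM: "\<And>i j. i < n \<Longrightarrow> j < n \<Longrightarrow> B $$ (i, j) \<le> M"
    and sr: "real_spectral_radius B \<le> \<rho>" and s: "0 \<le> \<rho>" "\<rho> < s" "s \<le> 1"
  shows "\<exists>w. \<forall>j<n. 1 \<le> w j \<and> (\<Sum>i<n. w i * B $$ (i, j)) \<le> s * w j \<and>
    w j \<le> fact n * (M + 1) ^ (n - 1) / (s - \<rho>) ^ n"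
proof -
  define N where "N = s \<cdot>\<^sub>m 1\<^sub>m n - B"
  have N: "N \<in> carrier_mat n n" using B by (simp add: N_def minus_carrier_mat)
  note adj = adj_mat[OF N]
  have "0 < (s - \<rho>) ^ n" using s by simp
  moreover have det: "(s - \<rho>) ^ n \<le> \<bar>det N\<bar>"
    unfolding N_def by (rule det_resolvent_ge[OF B sr]) (use s in simp)
  ultimately have det0: "det N \<noteq> 0" by auto
  \<comment> \<open>The inverse is written as adjugate over determinant, so that the upper bound can
    be read off later.\<close>
  define w where "w j = (\<Sum>i<n. adj_mat N $$ (i, j)) / det N" for j
  \<comment> \<open>Column j of the identity w^T (s I - B) = 1^T.\<close>
  have eq: "s * w j = 1 + (\<Sum>i<n. w i * B $$ (i, j))" if j: "j < n" for j
  proof -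
    have "(\<Sum>l<n. (\<Sum>i<n. adj_mat N $$ (i, l)) * N $$ (l, j))
        = (\<Sum>i<n. \<Sum>l<n. adj_mat N $$ (i, l) * N $$ (l, j))"
      by (subst sum.swap) (simp add: sum_distrib_right)
    also have "\<dots> = (\<Sum>i<n. (adj_mat N * N) $$ (i, j))"
      using adj(1) N j by (auto simp: scalar_prod_def atLeast0LessThan intro!: sum.cong)
    also have "\<dots> = (\<Sum>i<n. if i = j then det N else 0)"
      unfolding adj(3) using j by (intro sum.cong) auto
    finally have "(\<Sum>l<n. (\<Sum>i<n. adj_mat N $$ (i, l)) * N $$ (l, j)) = det N" using j by simp
    then have "1 = (\<Sum>l<n. (\<Sum>i<n. adj_mat N $$ (i, l)) * N $$ (l, j)) / det N" using det0 by simp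
    also have "\<dots> = (\<Sum>l<n. w l * N $$ (l, j))"
      by (simp only: w_def sum_divide_distrib[of "\<lambda>l. (\<Sum>i<n. adj_mat N $$ (i, l)) * N $$ (l, j)"]
          times_divide_eq_left)
    also have "\<dots> = (\<Sum>l<n. (if l = j then s * w j else 0) - w l * B $$ (l, j))"
      using B j by (auto simp: N_def algebra_simps intro!: sum.cong)
    also have "\<dots> = s * w j - (\<Sum>i<n. w i * B $$ (i, j))" using j by (simp add: sum_subtractf)
    finally show ?thesis by simp
  qed
  have iter: "(\<Sum>i<n. w i * (B ^\<^sub>m k) $$ (i, j)) \<le> s ^ k * w j" if j: "j < n" for j k
    using j
  proof (induction k arbitrary: j)
    case 0
    have "(\<Sum>i<n. w i * (B ^\<^sub>m 0) $$ (i, j)) = (\<Sum>i<n. if i = j then w j else 0)"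
      using B 0 by (intro sum.cong) auto
    then show ?case using 0 by simp
  next
    case (Suc k)
    have "(\<Sum>i<n. w i * (B ^\<^sub>m Suc k) $$ (i, j))
        = (\<Sum>i<n. \<Sum>l<n. w i * (B ^\<^sub>m k) $$ (i, l) * B $$ (l, j))"
      using B pow_carrier_mat[OF B, of k] Suc.prems
      by (auto simp: scalar_prod_def atLeast0LessThan sum_distrib_left mult_ac intro!: sum.cong)
    also have "\<dots> = (\<Sum>l<n. (\<Sum>i<n. w i * (B ^\<^sub>m k) $$ (i, l)) * B $$ (l, j))"
      by (subst sum.swap) (simp add: sum_distrib_right)
    also have "\<dots> \<le> (\<Sum>l<n. (s ^ k * w l) * B $$ (l, j))"
      by (intro sum_mono mult_right_mono) (auto simp: Suc B0)
    also have "\<dots> = s ^ k * (\<Sum>l<n. w l * B $$ (l, j))" by (simp add: sum_distrib_left mult_ac)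
    also have "\<dots> \<le> s ^ k * (s * w j)" using eq[OF Suc.prems] s by (intro mult_left_mono) auto
    finally show ?case by (simp add: mult_ac)
  qed
  \<comment> \<open>A rate strictly between the spectral radius and s, so that (t / s)^k tends to
    0.\<close>
  define t where "t = (\<rho> + s) / 2"
  have t: "real_spectral_radius B < t" "0 < t" "t < s" using sr s by (auto simp: t_def)
  obtain c where c: "\<And>k i j. i < n \<Longrightarrow> j < n \<Longrightarrow> \<bar>(B ^\<^sub>m k) $$ (i, j)\<bar> \<le> c * t ^ k"
    using pow_mat_decay[OF B n t(1)] by blast
  have w0: "0 \<le> w j" if j: "j < n" for j
  proof -
    define S where "S = (\<Sum>i<n. \<bar>w i\<bar> * c)"
    \<comment> \<open>Entry j of w^T B^k lies between - S t^k and s^k w_j; after division by s^k the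
      lower bound vanishes in the limit.\<close>
    have "- (S * (t / s) ^ k) \<le> w j" for k
    proof -
      have "\<bar>\<Sum>i<n. w i * (B ^\<^sub>m k) $$ (i, j)\<bar> \<le> (\<Sum>i<n. \<bar>w i\<bar> * (c * t ^ k))"
        using c[OF _ j] by (intro order.trans[OF sum_abs] sum_mono) (auto simp: abs_mult intro!: mult_left_mono)
      also have "\<dots> = S * t ^ k" by (simp add: S_def sum_distrib_left mult_ac)
      finally have "- (S * t ^ k) \<le> s ^ k * w j" using iter[OF j, of k] by linarith
      then show ?thesis using t s by (simp add: power_divide field_simps)
    qed
    moreover have "(\<lambda>k. - (S * (t / s) ^ k)) \<longlonglongrightarrow> - (S * 0)"
      using t by (intro tendsto_intros LIMSEQ_realpow_zero) auto
    ultimately show ?thesis by (intro LIMSEQ_le_const2[where a = "w j"]) auto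
  qed
  have "1 \<le> w j" if j: "j < n" for j
  proof -
    have "0 \<le> (\<Sum>i<n. w i * B $$ (i, j))" using w0 B0 j by (intro sum_nonneg) auto
    then have "1 \<le> s * w j" using eq[OF j] by simp
    also have "\<dots> \<le> 1 * w j" using s w0[OF j] by (intro mult_right_mono) auto
    finally show ?thesis by simp
  qed
  moreover have "w j \<le> fact n * (M + 1) ^ (n - 1) / (s - \<rho>) ^ n" if j: "j < n" for j
  proof -
    have NM: "\<bar>N $$ (i, l)\<bar> \<le> M + 1" if "i < n" "l < n" for i l
      using B B0[OF that] BM[OF that] that s by (auto simp: N_def)
    have M: "0 \<le> M" using B0[OF j j] BM[OF j j] by linarith
    have "\<bar>\<Sum>i<n. adj_mat N $$ (i, j)\<bar> \<le> (\<Sum>i<n. fact (n - 1) * (M + 1) ^ (n - 1))"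
      using adj_mat_abs_le[OF N NM] j by (intro order.trans[OF sum_abs] sum_mono) auto
    also have "\<dots> = fact n * (M + 1) ^ (n - 1)" using n by (simp add: fact_reduce[of n])
    finally have "\<bar>w j\<bar> \<le> fact n * (M + 1) ^ (n - 1) / \<bar>det N\<bar>"
      by (simp add: w_def divide_right_mono)
    also have "\<dots> \<le> fact n * (M + 1) ^ (n - 1) / (s - \<rho>) ^ n"
      using det s M det0 by (intro divide_left_mono mult_pos_pos mult_nonneg_nonneg) auto
    finally show ?thesis by simp
  qed
  ultimately show ?thesis using eq by (intro exI[of _ w]) auto
qed

section \<open>Rational data\<close>

lemma lcp_complementary:
  fixes u v :: "real vec"
  assumes "0\<^sub>v n \<le> u" "0\<^sub>v n \<le> v" "u \<bullet> v = 0"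
    and "u \<in> carrier_vec n" "v \<in> carrier_vec n" "i < n"
  shows "0 \<le> u $ i" "0 \<le> v $ i" "u $ i = 0 \<or> v $ i = 0"
proof -
  have nonneg: "0 \<le> u $ j \<and> 0 \<le> v $ j" if "j < n" for j
    using assms that unfolding less_eq_vec_def by auto
  then show "0 \<le> u $ i" "0 \<le> v $ i" using assms by auto
  have "(\<Sum>j\<in>{0..<n}. u $ j * v $ j) = 0" using assms by (simp add: scalar_prod_def)
  then have "\<forall>j\<in>{0..<n}. u $ j * v $ j = 0"
    using nonneg sum_nonneg_eq_0_iff[of "{0..<n}" "\<lambda>j. u $ j * v $ j"] by auto
  then show "u $ i = 0 \<or> v $ i = 0" using assms(6) by auto
qed

lemma det_nonzero_if_invertible_mat:
  fixes A :: "real mat"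
  assumes A: "A \<in> carrier_mat n n" and "invertible_mat A"
  shows "det A \<noteq> 0"
proof
  assume "det A = 0"
  then have "det (A * inv_mat A) = 0"
    using det_mult[OF A inv_mat_invertible(1)[OF assms]] by simp
  then show False using inv_mat_invertible(2)[OF assms] by simp
qed

locale rational_lcp =
  fixes n :: nat and Q :: "real mat" and q :: "real vec"
    and Qbar :: "int mat" and qbar :: "int vec" and dQ dq :: int
  assumes n: "n \<ge> 1"
    and Qbar: "Qbar \<in> carrier_mat n n" and qbar: "qbar \<in> carrier_vec n"
    and dQ: "dQ > 0" and dq: "dq > 0"
    and Q_def: "Q = (1 / real_of_int dQ) \<cdot>\<^sub>m map_mat real_of_int Qbar"
    and q_def: "q = (1 / real_of_int dq) \<cdot>\<^sub>v map_vec real_of_int qbar"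
    and inv_minus: "invertible_mat (1\<^sub>m n - Q)" and inv_plus: "invertible_mat (1\<^sub>m n + Q)"
begin

abbreviation "A \<equiv> ave_mat n Q"
abbreviation "R \<equiv> cayley n Q"
abbreviation "b \<equiv> ave_rhs n Q q"
abbreviation "L \<equiv> Lbar Qbar qbar dQ dq"

text \<open>This is \<open>(dQ / 2) (I - Q) (A - Diag z)\<close>: clearing denominators in the system solved
  by the method leaves an integral matrix.\<close>

definition pivot_mat :: "real vec \<Rightarrow> int mat" where
  "pivot_mat z = mat n n (\<lambda>(i, j). if z $ j = 1 then Qbar $$ (i, j) else if i = j then dQ else 0)"

section \<open>The Cayley transform and its inverse\<close>

lemma Q: "Q \<in> carrier_mat n n" and q: "q \<in> carrier_vec n"
  using Qbar qbar by (auto simp: Q_def q_def)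

lemma Q_minus: "1\<^sub>m n - Q \<in> carrier_mat n n" and Q_plus: "1\<^sub>m n + Q \<in> carrier_mat n n"
  using Q by (auto intro: minus_carrier_mat)

lemmas inv_minus_mat = inv_mat_invertible[OF Q_minus inv_minus]
lemmas inv_plus_mat = inv_mat_invertible[OF Q_plus inv_plus]

lemma A: "A \<in> carrier_mat n n" and R: "R \<in> carrier_mat n n" and b: "b \<in> carrier_vec n"
  using inv_minus_mat(1) inv_plus_mat(1) Q_minus Q_plus q
  by (auto simp: ave_mat_def cayley_def ave_rhs_def)

lemma A_mult: "A * (1\<^sub>m n - Q) = 1\<^sub>m n + Q"
  unfolding ave_mat_def using assoc_mult_mat[OF Q_plus inv_minus_mat(1) Q_minus] inv_minus_mat(3)
    right_mult_one_mat[OF Q_plus] by simp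

lemma R_mult: "R * (1\<^sub>m n + Q) = 1\<^sub>m n - Q"
  unfolding cayley_def using assoc_mult_mat[OF Q_minus inv_plus_mat(1) Q_plus] inv_plus_mat(3)
    right_mult_one_mat[OF Q_minus] by simp

lemma AR: "A * R = 1\<^sub>m n"
proof -
  have "A * R = (A * (1\<^sub>m n - Q)) * inv_mat (1\<^sub>m n + Q)"
    unfolding cayley_def using A Q_minus inv_plus_mat(1) by simp
  then show ?thesis using A_mult inv_plus_mat(2) by simp
qed

lemma RA: "R * A = 1\<^sub>m n"
proof -
  have "R * A = (R * (1\<^sub>m n + Q)) * inv_mat (1\<^sub>m n - Q)"
    unfolding ave_mat_def using R Q_plus inv_minus_mat(1) by simp
  then show ?thesis using R_mult inv_minus_mat(2) by simp
qed

text \<open>In \<open>ave_mat\<close> the inverse of I - Q stands on the right, but it has to be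
  cleared from the left; I - Q and I + Q commute.\<close>

lemma minus_mult_A: "(1\<^sub>m n - Q) * A = 1\<^sub>m n + Q"
proof -
  have comm: "(1\<^sub>m n - Q) * (1\<^sub>m n + Q) = (1\<^sub>m n + Q) * (1\<^sub>m n - Q)"
  proof -
    have "(1\<^sub>m n - Q) * (1\<^sub>m n + Q) = (1\<^sub>m n - Q) + (Q - Q * Q)"
      using Q mult_add_distrib_mat[OF Q_minus one_carrier_mat Q] minus_mult_distrib_mat[OF one_carrier_mat Q Q]
        right_mult_one_mat[OF Q_minus] by simp
    also have "\<dots> = (1\<^sub>m n + Q) - (Q + Q * Q)" using Q by (auto simp: mat_eq_iff)
    also have "\<dots> = (1\<^sub>m n + Q) * (1\<^sub>m n - Q)"
      using Q mult_minus_distrib_mat[OF Q_plus one_carrier_mat Q] add_mult_distrib_mat[OF one_carrier_mat Q Q]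
        right_mult_one_mat[OF Q_plus] by simp
    finally show ?thesis .
  qed
  have "(1\<^sub>m n - Q) * A = ((1\<^sub>m n - Q) * (1\<^sub>m n + Q)) * inv_mat (1\<^sub>m n - Q)"
    unfolding ave_mat_def using Q_minus Q_plus inv_minus_mat(1) by simp
  also have "\<dots> = (1\<^sub>m n + Q) * ((1\<^sub>m n - Q) * inv_mat (1\<^sub>m n - Q))"
    unfolding comm using Q_minus Q_plus inv_minus_mat(1) by simp
  finally show ?thesis using inv_minus_mat(2) right_mult_one_mat[OF Q_plus] by simp
qed

lemma minus_mult_b: "(1\<^sub>m n - Q) *\<^sub>v b = (- 2) \<cdot>\<^sub>v q"
proof -
  have "(1\<^sub>m n - Q) *\<^sub>v b = (- 2) \<cdot>\<^sub>v ((1\<^sub>m n - Q) *\<^sub>v (inv_mat (1\<^sub>m n - Q) *\<^sub>v q))"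
    unfolding ave_rhs_def using Q_minus inv_minus_mat(1) q by (intro mult_mat_vec) auto
  also have "(1\<^sub>m n - Q) *\<^sub>v (inv_mat (1\<^sub>m n - Q) *\<^sub>v q) = q"
    using assoc_mult_mat_vec[OF Q_minus inv_minus_mat(1) q] inv_minus_mat(2) q by simp
  finally show ?thesis .
qed

section \<open>Equivalence with the linear complementarity problem\<close>

lemma minus_mult_inj:
  assumes "x \<in> carrier_vec n" "y \<in> carrier_vec n"
  shows "(1\<^sub>m n - Q) *\<^sub>v x = (1\<^sub>m n - Q) *\<^sub>v y \<longleftrightarrow> x = y"
proof
  assume eq: "(1\<^sub>m n - Q) *\<^sub>v x = (1\<^sub>m n - Q) *\<^sub>v y"
  have "u = inv_mat (1\<^sub>m n - Q) *\<^sub>v ((1\<^sub>m n - Q) *\<^sub>v u)" if "u \<in> carrier_vec n" for u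
    using assoc_mult_mat_vec[OF inv_minus_mat(1) Q_minus that] inv_minus_mat(3) that by simp
  then show "x = y" using eq assms by metis
qed simp

text \<open>The vector t is arbitrary: t = |x| leads to the complementarity problem, t = Z x to the
  integral systems of the method.\<close>

lemma minus_mult_residual:
  assumes x: "x \<in> carrier_vec n" and t: "t \<in> carrier_vec n"
  shows "(1\<^sub>m n - Q) *\<^sub>v (A *\<^sub>v x - t) = (x - t) + Q *\<^sub>v (x + t)"
proof -
  have "(1\<^sub>m n - Q) *\<^sub>v (A *\<^sub>v x - t) = (1\<^sub>m n - Q) *\<^sub>v (A *\<^sub>v x) - (1\<^sub>m n - Q) *\<^sub>v t"
    using A x t by (intro mult_minus_distrib_mat_vec[OF Q_minus]) auto
  also have "(1\<^sub>m n - Q) *\<^sub>v (A *\<^sub>v x) = (1\<^sub>m n + Q) *\<^sub>v x"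
    using assoc_mult_mat_vec[OF Q_minus A x] minus_mult_A by simp
  also have "\<dots> = x + Q *\<^sub>v x" using add_mult_distrib_mat_vec[OF one_carrier_mat Q x] x by simp
  also have "(1\<^sub>m n - Q) *\<^sub>v t = t - Q *\<^sub>v t"
    using minus_mult_distrib_mat_vec[OF one_carrier_mat Q t] t by simp
  also have "(x + Q *\<^sub>v x) - (t - Q *\<^sub>v t) = (x - t) + (Q *\<^sub>v x + Q *\<^sub>v t)"
    using x t Q by (auto simp: vec_eq_iff)
  also have "Q *\<^sub>v x + Q *\<^sub>v t = Q *\<^sub>v (x + t)" using mult_add_distrib_mat_vec[OF Q x t] by simp
  finally show ?thesis .
qed

text \<open>With u = (t + x) / 2 and v = (t - x) / 2 the right side reads v = Q u + q. Multiplying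
  the left side by the nonsingular I - Q turns it into this, up to the factor -2.\<close>

lemma residual_eq_b_iff:
  assumes x: "x \<in> carrier_vec n" and t: "t \<in> carrier_vec n"
  shows "A *\<^sub>v x - t = b \<longleftrightarrow> (1 / 2) \<cdot>\<^sub>v (t - x) = Q *\<^sub>v ((1 / 2) \<cdot>\<^sub>v (t + x)) + q"
proof -
  have "A *\<^sub>v x - t \<in> carrier_vec n" using A x t by simp
  then have "A *\<^sub>v x - t = b \<longleftrightarrow> (x - t) + Q *\<^sub>v (x + t) = (- 2) \<cdot>\<^sub>v q"
    using minus_mult_inj[of "A *\<^sub>v x - t" b] b minus_mult_residual[OF x t] minus_mult_b by simp
  moreover have "x + t = t + x" using comm_add_vec[OF x t] .
  moreover have "Q *\<^sub>v ((1 / 2) \<cdot>\<^sub>v (t + x)) = (1 / 2) \<cdot>\<^sub>v (Q *\<^sub>v (t + x))"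
    using Q x t by (intro mult_mat_vec) auto
  moreover have "(x - t) + c = (- 2) \<cdot>\<^sub>v q \<longleftrightarrow> (1 / 2) \<cdot>\<^sub>v (t - x) = (1 / 2) \<cdot>\<^sub>v c + q"
    if c: "c \<in> carrier_vec n" for c
  proof -
    have "(x - t) + c = (- 2) \<cdot>\<^sub>v q \<longleftrightarrow> (\<forall>i<n. x $ i - t $ i + c $ i = - 2 * q $ i)"
      using x t c q by (auto simp: vec_eq_iff)
    also have "\<dots> \<longleftrightarrow> (\<forall>i<n. 1 / 2 * (t $ i - x $ i) = 1 / 2 * c $ i + q $ i)"
      by (intro all_cong) (auto simp: field_simps)
    also have "\<dots> \<longleftrightarrow> (1 / 2) \<cdot>\<^sub>v (t - x) = (1 / 2) \<cdot>\<^sub>v c + q"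
      using x t c q by (auto simp: vec_eq_iff)
    finally show ?thesis .
  qed
  ultimately show ?thesis using Q x t by simp
qed

text \<open>The two vectors are the positive and negative parts of x, hence nonnegative and
  complementary.\<close>

lemma ave_imp_lcp:
  assumes "ave_solution n A b x"
  shows "lcp_solution n Q q ((1 / 2) \<cdot>\<^sub>v (abs_vec x + x)) ((1 / 2) \<cdot>\<^sub>v (abs_vec x - x))"
proof -
  have x: "x \<in> carrier_vec n" "A *\<^sub>v x - abs_vec x = b" using assms by (auto simp: ave_solution_def)
  note ax = abs_vec_carrier[OF x(1)]
  have abs: "abs_vec x $ i = \<bar>x $ i\<bar>" if "i < n" for i using x(1) that by (simp add: abs_vec_def)
  have "(1 / 2) \<cdot>\<^sub>v (abs_vec x - x) = Q *\<^sub>v ((1 / 2) \<cdot>\<^sub>v (abs_vec x + x)) + q"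
    using residual_eq_b_iff[OF x(1) ax] x(2) by simp
  moreover have "((1 / 2) \<cdot>\<^sub>v (abs_vec x + x)) \<bullet> ((1 / 2) \<cdot>\<^sub>v (abs_vec x - x)) = 0"
    using x(1) ax by (auto simp: scalar_prod_def abs abs_if intro!: sum.neutral)
  moreover have "0\<^sub>v n \<le> (1 / 2) \<cdot>\<^sub>v (abs_vec x + x)" "0\<^sub>v n \<le> (1 / 2) \<cdot>\<^sub>v (abs_vec x - x)"
    using x(1) ax by (auto simp: less_eq_vec_def abs)
  moreover have "(1 / 2) \<cdot>\<^sub>v (abs_vec x + x) \<in> carrier_vec n" "(1 / 2) \<cdot>\<^sub>v (abs_vec x - x) \<in> carrier_vec n"
    using x(1) ax by auto
  ultimately show ?thesis unfolding lcp_solution_def by blast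
qed

text \<open>Both u_i and v_i are nonnegative and one of them vanishes, so |u - v| = u + v. As u and
  v are recovered from u - v, uniqueness carries over from the absolute value equation.\<close>

lemma lcp_imp_ave:
  assumes "lcp_solution n Q q u v"
  shows "ave_solution n A b (u - v)"
    and "u = (1 / 2) \<cdot>\<^sub>v (abs_vec (u - v) + (u - v))" "v = (1 / 2) \<cdot>\<^sub>v (abs_vec (u - v) - (u - v))"
proof -
  have uv: "u \<in> carrier_vec n" "v \<in> carrier_vec n" and eq: "v = Q *\<^sub>v u + q"
    and compl: "0\<^sub>v n \<le> u" "0\<^sub>v n \<le> v" "u \<bullet> v = 0"
    using assms by (auto simp: lcp_solution_def)
  have "abs_vec (u - v) $ i = u $ i + v $ i" if i: "i < n" for i
    using lcp_complementary[OF compl uv i] uv i by (auto simp: abs_vec_def)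
  then have abs: "abs_vec (u - v) = u + v" using uv by (intro eq_vecI) (auto simp: abs_vec_def)
  show u: "u = (1 / 2) \<cdot>\<^sub>v (abs_vec (u - v) + (u - v))"
    and v: "v = (1 / 2) \<cdot>\<^sub>v (abs_vec (u - v) - (u - v))"
    unfolding abs using uv by (auto simp: vec_eq_iff)
  have "(1 / 2) \<cdot>\<^sub>v (abs_vec (u - v) - (u - v)) = Q *\<^sub>v ((1 / 2) \<cdot>\<^sub>v (abs_vec (u - v) + (u - v))) + q"
    using eq u v by simp
  then show "ave_solution n A b (u - v)"
    using uv residual_eq_b_iff[of "u - v" "abs_vec (u - v)"] abs_vec_carrier[of "u - v" n]
    by (auto simp: ave_solution_def)
qed

section \<open>Integral systems and size bounds\<close>

lemma L_bounds:
  shows "dq \<le> L" "dQ \<le> L" "1 \<le> L"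
    and "\<And>i j. i < n \<Longrightarrow> j < n \<Longrightarrow> \<bar>Qbar $$ (i, j)\<bar> \<le> L"
    and "\<And>i. i < n \<Longrightarrow> \<bar>qbar $ i\<bar> \<le> L"
proof -
  have fin: "finite {dq, dQ, inf_norm_vec qbar, max_norm_mat Qbar}" by simp
  show "dq \<le> L" "dQ \<le> L" unfolding Lbar_def by (auto intro: Max_ge[OF fin])
  then show "1 \<le> L" using dq by linarith
  fix i assume i: "i < n"
  have "\<bar>qbar $ i\<bar> \<le> inf_norm_vec qbar" unfolding inf_norm_vec_def
    using qbar i by (intro Max_ge) (auto simp: vec_set_def)
  also have "\<dots> \<le> L" unfolding Lbar_def by (rule Max_ge[OF fin]) simp
  finally show "\<bar>qbar $ i\<bar> \<le> L" .
  fix j assume j: "j < n"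
  have "Qbar $$ (i, j) \<in> elements_mat Qbar" using Qbar i j by blast
  moreover have "finite (elements_mat Qbar)" unfolding elements_mat_def by simp
  ultimately have "\<bar>Qbar $$ (i, j)\<bar> \<le> max_norm_mat Qbar"
    unfolding max_norm_mat_def by (intro Max_ge) auto
  also have "\<dots> \<le> L" unfolding Lbar_def by (rule Max_ge[OF fin]) simp
  finally show "\<bar>Qbar $$ (i, j)\<bar> \<le> L" .
qed

lemma pivot_mat_carrier: "pivot_mat z \<in> carrier_mat n n"
  by (simp add: pivot_mat_def)

text \<open>Let t = Z x. If z_j = 1 then x_j - t_j = 0 and x_j + t_j = 2 x_j, which selects column j
  of \<open>Qbar\<close>; if z_j = -1 the roles are exchanged and \<open>dQ\<close> times a unit
  vector appears.\<close>

lemma pivot_mat_mult: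
  assumes z: "z \<in> sign_vecs n" and x: "x \<in> carrier_vec n"
  shows "map_mat real_of_int (pivot_mat z) *\<^sub>v x =
    (real_of_int dQ / 2) \<cdot>\<^sub>v ((1\<^sub>m n - Q) *\<^sub>v ((A - Diag z) *\<^sub>v x))" (is "?l = ?r")
proof (rule eq_vecI)
  have zc: "z \<in> carrier_vec n" using z by (simp add: sign_vecs_def)
  define t where "t = Diag z *\<^sub>v x"
  have t: "t \<in> carrier_vec n" and ti: "\<And>i. i < n \<Longrightarrow> t $ i = z $ i * x $ i"
    by (auto simp: t_def Diag_mult_vec[OF zc x])
  have r: "?r = (real_of_int dQ / 2) \<cdot>\<^sub>v ((x - t) + Q *\<^sub>v (x + t))"
    unfolding minus_mult_distrib_mat_vec[OF A Diag_carrier[OF zc] x] t_def[symmetric]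
    using minus_mult_residual[OF x t] by simp
  show "dim_vec ?l = dim_vec ?r" unfolding r using Q x t by (simp add: pivot_mat_def)
  fix i assume "i < dim_vec ?r"
  then have i: "i < n" unfolding r using Q by simp
  have sgn: "z $ j = 1 \<or> z $ j = - 1" if "j < n" for j using z that by (auto simp: sign_vecs_def)
  have "?l $ i = (\<Sum>j\<in>{0..<n}. real_of_int (pivot_mat z $$ (i, j)) * x $ j)"
    using i x by (simp add: scalar_prod_def pivot_mat_def)
  also have "\<dots> = (\<Sum>j\<in>{0..<n}. (if j = i then real_of_int dQ / 2 * (x $ i - t $ i) else 0)
      + real_of_int (Qbar $$ (i, j)) / 2 * (x $ j + t $ j))"
  proof (rule sum.cong)
    fix j assume "j \<in> {0..<n}"
    then have j: "j < n" by simp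
    from sgn[OF j] show "real_of_int (pivot_mat z $$ (i, j)) * x $ j =
        (if j = i then real_of_int dQ / 2 * (x $ i - t $ i) else 0)
          + real_of_int (Qbar $$ (i, j)) / 2 * (x $ j + t $ j)"
      using i j by (auto simp: pivot_mat_def ti)
  qed simp
  also have "\<dots> = real_of_int dQ / 2 * (x $ i - t $ i)
      + (\<Sum>j\<in>{0..<n}. real_of_int (Qbar $$ (i, j)) / 2 * (x $ j + t $ j))"
    using i by (simp add: sum.distrib)
  also have "(\<Sum>j\<in>{0..<n}. real_of_int (Qbar $$ (i, j)) / 2 * (x $ j + t $ j))
      = real_of_int dQ / 2 * (Q *\<^sub>v (x + t)) $ i"
    using i Qbar x t dQ by (auto simp: scalar_prod_def Q_def sum_distrib_left intro!: sum.cong)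
  finally show "?l $ i = ?r $ i" unfolding r using i x t Q by (simp add: algebra_simps)
qed

lemma pivot_mat_det:
  assumes z: "z \<in> sign_vecs n" and inv: "invertible_mat (A - Diag z)"
  shows "det (pivot_mat z) \<noteq> 0"
proof -
  have zc: "z \<in> carrier_vec n" using z by (simp add: sign_vecs_def)
  have AD: "A - Diag z \<in> carrier_mat n n" using Diag_carrier[OF zc] by (rule minus_carrier_mat)
  have P: "map_mat real_of_int (pivot_mat z) \<in> carrier_mat n n" by (simp add: pivot_mat_carrier)
  have "x = 0\<^sub>v n"
    if x: "x \<in> carrier_vec n" and eq: "map_mat real_of_int (pivot_mat z) *\<^sub>v x = 0\<^sub>v n" for x
  proof -
    let ?y = "(A - Diag z) *\<^sub>v x"
    have y: "?y \<in> carrier_vec n" by (rule mult_mat_vec_carrier[OF AD x])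
    have "(1\<^sub>m n - Q) *\<^sub>v ?y = (1\<^sub>m n - Q) *\<^sub>v 0\<^sub>v n"
      using eq dQ Q_minus Q y unfolding pivot_mat_mult[OF z x] by (auto simp: vec_eq_iff)
    then have "?y = 0\<^sub>v n" using minus_mult_inj[OF y] by simp
    then show ?thesis
      using det_nonzero_if_invertible_mat[OF AD inv] det_0_iff_vec_prod_zero_field[OF AD] x by blast
  qed
  then have "det (map_mat real_of_int (pivot_mat z)) \<noteq> 0"
    using det_0_iff_vec_prod_zero_field[OF P] by blast
  then show ?thesis by simp
qed

lemma fact_L_le: "fact n * real_of_int L ^ n \<le> (real n * real_of_int L) ^ n"
proof -
  have "fact n * real_of_int L ^ n \<le> real n ^ n * real_of_int L ^ n"
    using fact_le_power[of n] L_bounds(3) by (intro mult_right_mono) auto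
  then show ?thesis by (simp add: power_mult_distrib)
qed

lemma L_le: "real_of_int L \<le> real n * real_of_int L"
  using mult_right_mono[of 1 "real n" "real_of_int L"] n L_bounds(3) by simp

text \<open>The vector \<open>dq\<close> x solves the integral system with matrix
  \<open>pivot_mat z\<close> and right side - \<open>dQ\<close> \<open>qbar\<close>, whose entries
  are at most L and L^2. Cramer's rule and n! <= n^n do the rest.\<close>

lemma gnm_point_bounds:
  assumes z: "z \<in> sign_vecs n" and inv: "invertible_mat (A - Diag z)" and x: "x \<in> carrier_vec n"
    and eq: "(A - Diag z) *\<^sub>v x = b" and i: "i < n"
  shows "\<bar>x $ i\<bar> \<le> (real n * real_of_int L) ^ (n + 1)"
    and "x $ i \<noteq> 0 \<Longrightarrow> 1 / (real n * real_of_int L) ^ (n + 1) \<le> \<bar>x $ i\<bar>"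
proof -
  let ?K = "real n * real_of_int L"
  define y where "y = real_of_int dq \<cdot>\<^sub>v x"
  define c where "c = (- dQ) \<cdot>\<^sub>v qbar"
  have y: "y \<in> carrier_vec n" and c: "c \<in> carrier_vec n" using x qbar by (auto simp: y_def c_def)
  have P: "map_mat real_of_int (pivot_mat z) \<in> carrier_mat n n" by (simp add: pivot_mat_carrier)
  have sys: "map_mat real_of_int (pivot_mat z) *\<^sub>v y = map_vec real_of_int c"
    unfolding y_def mult_mat_vec[OF P x] pivot_mat_mult[OF z x] eq minus_mult_b
    using dq qbar by (auto simp: vec_eq_iff c_def q_def)
  have B: "\<bar>pivot_mat z $$ (i, j)\<bar> \<le> L" if "i < n" "j < n" for i j
    using L_bounds(2,3) L_bounds(4)[OF that] dQ that by (auto simp: pivot_mat_def)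
  have B': "\<bar>c $ i\<bar> \<le> L * L" if "i < n" for i
    using L_bounds(2,3) L_bounds(5)[OF that] dQ that qbar by (auto simp: c_def abs_mult intro!: mult_mono)
  note bounds = integral_system_bounds[OF pivot_mat_carrier c y pivot_mat_det[OF z inv] sys B B' i]
  have yi: "\<bar>y $ i\<bar> = real_of_int dq * \<bar>x $ i\<bar>" using x i dq by (simp add: y_def abs_mult)
  have L1: "1 \<le> real_of_int L" using L_bounds(3) by simp
  have K0: "0 < ?K" using n L1 by simp
  have nL: "fact n * real_of_int L ^ n * real_of_int L \<le> ?K ^ (n + 1)"
    using mult_mono[OF fact_L_le L_le] L1 K0 by (simp add: mult_ac)
  have "1 * \<bar>x $ i\<bar> \<le> \<bar>y $ i\<bar>" unfolding yi using dq by (intro mult_right_mono) auto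
  also have "\<dots> \<le> fact n * real_of_int L ^ (n - 1) * real_of_int (L * L)" by (rule bounds(1))
  also have "\<dots> = fact n * real_of_int L ^ n * real_of_int L"
    using n by (cases n) simp_all
  finally show "\<bar>x $ i\<bar> \<le> ?K ^ (n + 1)" using nL by simp
  assume "x $ i \<noteq> 0"
  then have "y $ i \<noteq> 0" using dq x i by (simp add: y_def)
  then have "1 \<le> \<bar>x $ i\<bar> * (fact n * real_of_int L ^ n * real_of_int dq)"
    using bounds(2) yi by (simp add: mult_ac)
  also have "\<dots> \<le> \<bar>x $ i\<bar> * (fact n * real_of_int L ^ n * real_of_int L)"
    using L_bounds(1) L1 by (intro mult_left_mono) auto
  also have "\<dots> \<le> \<bar>x $ i\<bar> * ?K ^ (n + 1)" using nL by (intro mult_left_mono) auto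
  finally show "1 / ?K ^ (n + 1) \<le> \<bar>x $ i\<bar>" using K0 by (simp add: divide_le_eq)
qed

text \<open>Row i of R (I + Q) = I - Q, multiplied by \<open>dQ\<close> and transposed, is an
  integral system for row i of R with entries at most 2 L.\<close>

lemma cayley_abs_le:
  assumes i: "i < n" and j: "j < n"
  shows "\<bar>R $$ (i, j)\<bar> \<le> (2 * (real n * real_of_int L)) ^ n"
proof -
  define P where "P = dQ \<cdot>\<^sub>m 1\<^sub>m n + Qbar"
  define c where "c = vec n (\<lambda>l. (if i = l then dQ else 0) - Qbar $$ (i, l))"
  have P: "P \<in> carrier_mat n n" and P': "transpose_mat P \<in> carrier_mat n n"
    and c: "c \<in> carrier_vec n" using Qbar by (auto simp: P_def c_def)
  have PQ: "map_mat real_of_int P = real_of_int dQ \<cdot>\<^sub>m (1\<^sub>m n + Q)"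
    using Qbar dQ by (auto simp: P_def Q_def mat_eq_iff algebra_simps)
  have "det (map_mat real_of_int P) \<noteq> 0"
    unfolding PQ using det_nonzero_if_invertible_mat[OF Q_plus inv_plus] dQ by simp
  then have det: "det (transpose_mat P) \<noteq> 0" using det_transpose[OF P] by simp
  have sys: "map_mat real_of_int (transpose_mat P) *\<^sub>v row R i = map_vec real_of_int c"
  proof (rule eq_vecI)
    fix l assume "l < dim_vec (map_vec real_of_int c)"
    then have l: "l < n" by (simp add: c_def)
    have "(map_mat real_of_int (transpose_mat P) *\<^sub>v row R i) $ l
        = col (map_mat real_of_int P) l \<bullet> row R i"
      using l P by (simp flip: map_mat_transpose)
    also have "\<dots> = (R * map_mat real_of_int P) $$ (i, l)"
      using l i P R by (simp add: comm_scalar_prod[of _ n])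
    also have "R * map_mat real_of_int P = real_of_int dQ \<cdot>\<^sub>m (1\<^sub>m n - Q)"
      unfolding PQ using mult_smult_distrib[OF R Q_plus] R_mult by simp
    finally show "(map_mat real_of_int (transpose_mat P) *\<^sub>v row R i) $ l = map_vec real_of_int c $ l"
      using i l Qbar dQ by (simp add: c_def Q_def algebra_simps)
  qed (use P in \<open>simp add: c_def\<close>)
  have B: "\<bar>transpose_mat P $$ (k, l)\<bar> \<le> 2 * L" if "k < n" "l < n" for k l
    using L_bounds(2,3) L_bounds(4)[OF that(2,1)] dQ that Qbar by (auto simp: P_def)
  have B': "\<bar>c $ l\<bar> \<le> 2 * L" if "l < n" for l
    using L_bounds(2,3) L_bounds(4)[OF i that] dQ that by (auto simp: c_def)
  have row: "row R i \<in> carrier_vec n" using R by (auto simp: row_def)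
  have "\<bar>R $$ (i, j)\<bar> = \<bar>row R i $ j\<bar>" using R i j by simp
  also have "\<dots> \<le> fact n * real_of_int (2 * L) ^ (n - 1) * real_of_int (2 * L)"
    by (rule integral_system_bounds(1)[OF P' c row det sys B B' j])
  also have "\<dots> = 2 ^ n * (fact n * real_of_int L ^ n)"
    using n by (cases n) (simp_all add: power_mult_distrib)
  also have "\<dots> \<le> 2 ^ n * (real n * real_of_int L) ^ n" using fact_L_le by simp
  finally show ?thesis by (simp add: power_mult_distrib)
qed

text \<open>This keeps ln (n L) away from 0, so that constants can be absorbed into multiples of it.
  Otherwise n = L = 1 and Q is -1, 0 or 1; nonsingularity excludes -1 and 1, and Q = 0 gives R = I
  of spectral radius 1.\<close>

lemma two_le_size:
  assumes sr: "real_spectral_radius (abs_mat R) \<le> \<rho>" and \<rho>: "\<rho> < 1"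
  shows "2 \<le> real n * real_of_int L"
proof (rule ccontr)
  assume small: "\<not> ?thesis"
  have L1: "1 \<le> real_of_int L" using L_bounds(3) by simp
  have "real n * 1 \<le> real n * real_of_int L" using L1 by (intro mult_left_mono) auto
  then have "real n < 2" "real_of_int L < 2" using small L_le by linarith+
  then have n1: "n = 1" and L1: "L = 1" using n L_bounds(3) by auto
  then have d: "dQ = 1" and Q1: "\<bar>Qbar $$ (0, 0)\<bar> \<le> 1" using L_bounds(2) dQ L_bounds(4)[of 0 0] by auto
  have Q00: "Q $$ (0, 0) = real_of_int (Qbar $$ (0, 0))" using Qbar n1 d by (simp add: Q_def)
  have "det (1\<^sub>m n - Q) \<noteq> 0" "det (1\<^sub>m n + Q) \<noteq> 0"
    using det_nonzero_if_invertible_mat Q_minus Q_plus inv_minus inv_plus by blast+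
  then have "1 - Q $$ (0, 0) \<noteq> 0" "1 + Q $$ (0, 0) \<noteq> 0"
    using Q Q_minus Q_plus n1 by (simp_all add: det_single)
  then have "Qbar $$ (0, 0) \<noteq> 1" "Qbar $$ (0, 0) \<noteq> -1" using Q00 by auto
  then have "Qbar $$ (0, 0) = 0" using Q1 by linarith
  then have "Q = 0\<^sub>m n n" using Q Q00 n1 by (auto simp: mat_eq_iff)
  then have "1\<^sub>m n - Q = 1\<^sub>m n" "1\<^sub>m n + Q = 1\<^sub>m n" by (auto simp: mat_eq_iff)
  then have "R = 1\<^sub>m n" using R_mult right_mult_one_mat[OF R] by simp
  then have "abs_mat R = 1\<^sub>m n" by (auto simp: abs_mat_def mat_eq_iff)
  \<comment> \<open>The resolvent bound at s = 1: a positive number below det (I - I) = 0.\<close>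
  then have "(1 - \<rho>) ^ n \<le> \<bar>det (1 \<cdot>\<^sub>m 1\<^sub>m n - 1\<^sub>m n :: real mat)\<bar>"
    using det_resolvent_ge[of "abs_mat R" n \<rho> 1] sr \<rho> by simp
  moreover have "det (1 \<cdot>\<^sub>m 1\<^sub>m n - 1\<^sub>m n :: real mat) = 0"
    using n1 by (simp add: det_single minus_carrier_mat)
  ultimately show False using \<rho> n1 by simp
qed

end

section \<open>Iteration complexity\<close>

text \<open>Logarithms bound k - 1. The coefficient 2 n + 3 collects n + 1 from each of the two
  powers of K and 1 from n <= K. As ln K >= ln 2, the constants, including the 1 in k - 1, become
  multiples of ln K.\<close>

lemma geometric_count_bound:
  fixes K W \<sigma> :: real and k n :: nat
  assumes K: "2 \<le> K" "real n \<le> K" and W: "1 \<le> W" and \<sigma>: "0 < \<sigma>" "\<sigma> < 1"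
    and le: "0 < k \<Longrightarrow> 2 * (1 - \<sigma>) * (1 / K ^ (n + 1)) \<le> \<sigma> ^ (k - 1) * (2 * (real n * W * K ^ (n + 1)))"
  shows "real k \<le> ln K / ln 2 + (- ln (1 - \<sigma>) / ln 2 * ln K + ln W + (2 * real n + 3) * ln K) / - ln \<sigma>"
proof -
  let ?X = "- ln (1 - \<sigma>) / ln 2 * ln K + ln W + (2 * real n + 3) * ln K"
  have K0: "0 < K" and lnK: "ln 2 \<le> ln K" "0 \<le> ln K" using K by auto
  have \<theta>: "0 < - ln \<sigma>" and c: "0 \<le> - ln (1 - \<sigma>)" using \<sigma> by auto
  have "- ln (1 - \<sigma>) / ln 2 * ln 2 \<le> - ln (1 - \<sigma>) / ln 2 * ln K"
    using c lnK by (intro mult_left_mono divide_nonneg_pos) auto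
  then have c1: "- ln (1 - \<sigma>) \<le> - ln (1 - \<sigma>) / ln 2 * ln K" by simp
  have X0: "0 \<le> ?X" using c1 c W lnK by (intro add_nonneg_nonneg) auto
  have one: "1 \<le> ln K / ln 2" using lnK by (simp add: le_divide_eq)
  show ?thesis
  proof (cases "k = 0")
    case True
    have "0 \<le> ?X / - ln \<sigma>" using X0 \<theta> by (intro divide_nonneg_pos)
    then show ?thesis using True one by linarith
  next
    case False
    have "2 * ((1 - \<sigma>) / K ^ (n + 1)) \<le> 2 * (\<sigma> ^ (k - 1) * (real n * W * K ^ (n + 1)))"
      using le False by (simp only: mult.assoc mult.left_commute[of _ 2] times_divide_eq_right mult_1_right)
    then have "(1 - \<sigma>) / K ^ (n + 1) \<le> \<sigma> ^ (k - 1) * (real n * W * K ^ (n + 1))" by linarith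
    then have "1 - \<sigma> \<le> \<sigma> ^ (k - 1) * (real n * W * K ^ (n + 1)) * K ^ (n + 1)"
      using K0 by (simp add: pos_divide_le_eq)
    also have "\<dots> = \<sigma> ^ (k - 1) * (W * (K ^ (n + 1) * K ^ (n + 1))) * real n" by (simp add: mult_ac)
    also have "\<dots> \<le> \<sigma> ^ (k - 1) * (W * (K ^ (n + 1) * K ^ (n + 1))) * K"
      using K W \<sigma> by (intro mult_left_mono) auto
    also have "\<dots> = \<sigma> ^ (k - 1) * W * K ^ (2 * n + 3)"
    proof -
      have "2 * n + 3 = (n + 1) + (n + 1) + 1" by simp
      then show ?thesis by (simp only: power_add power_one_right mult.assoc)
    qed
    finally have "ln (1 - \<sigma>) \<le> ln (\<sigma> ^ (k - 1) * W * K ^ (2 * n + 3))"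
      using \<sigma> K0 W by (intro ln_mono) auto
    also have "\<dots> = real (k - 1) * ln \<sigma> + ln W + real (2 * n + 3) * ln K"
      using \<sigma> K0 W by (simp add: ln_mult ln_realpow)
    finally have "(real k - 1) * - ln \<sigma> \<le> - ln (1 - \<sigma>) + ln W + (2 * real n + 3) * ln K"
      using False by (simp add: of_nat_diff algebra_simps)
    also have "\<dots> \<le> ?X" using c1 by simp
    finally have "real k - 1 \<le> ?X / - ln \<sigma>" by (simp only: pos_le_divide_eq[OF \<theta>])
    then show ?thesis using one by linarith
  qed
qed

context rational_lcp
begin

lemma weighted_ave_cayley:
  assumes "\<And>i. i < n \<Longrightarrow> 1 \<le> w i" "\<And>j. j < n \<Longrightarrow> (\<Sum>i<n. w i * \<bar>R $$ (i, j)\<bar>) \<le> s * w j"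
    and "0 \<le> s" "s < 1 / 2"
  shows "weighted_ave n A R b w s"
  using assms A R b AR RA by unfold_locales

text \<open>Cramer's rule supplies \<eta> = 1 / K^(n + 1). The initial gap is at most 2 n W K^(n +
  1), since the final norm and the negated initial potential are sums of n terms of size at most W
  K^(n + 1).\<close>

lemma gnm_run_bound:
  assumes wt: "\<And>i. i < n \<Longrightarrow> 1 \<le> w i" "\<And>j. j < n \<Longrightarrow> (\<Sum>i<n. w i * \<bar>R $$ (i, j)\<bar>) \<le> s * w j"
    and W: "\<And>i. i < n \<Longrightarrow> w i \<le> W" and s_pos: "0 < s" "s < 1 / 2"
    and K: "2 \<le> real n * real_of_int L" and z: "z \<in> sign_vecs n" and run: "gnm_run A b z k x"
  defines "K \<equiv> real n * real_of_int L"
  shows "real k \<le> ln K / ln 2 +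
    (- ln (1 - 2 * s) / ln 2 * ln K + ln W + (2 * real n + 3) * ln K) / - ln (2 * s)"
proof -
  interpret weighted_ave n A R b w s by (rule weighted_ave_cayley[OF wt less_imp_le[OF s_pos(1)] s_pos(2)])
  let ?E = "K ^ (n + 1)"
  have bounds: "\<bar>gnm_point A b z $ i\<bar> \<le> ?E"
      "gnm_point A b z $ i \<noteq> 0 \<Longrightarrow> 1 / ?E \<le> \<bar>gnm_point A b z $ i\<bar>"
    if "z \<in> sign_vecs n" "i < n" for z i
    using gnm_point_bounds[OF that(1) invertible_shifted gnm_point_carrier gnm_point_eq(1) that(2)] that
    unfolding K_def by auto
  obtain z' where z': "z' \<in> sign_vecs n" "mismatch A b z' = {}" "x = gnm_point A b z'"
    using gnm_run_final[OF run z] by auto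
  have W1: "1 \<le> W" using wt(1)[of 0] W[of 0] n by linarith
  have E0: "0 \<le> ?E" using K by (simp add: K_def)
  have le: "w i * \<bar>gnm_point A b z $ i\<bar> \<le> W * ?E" if "z \<in> sign_vecs n" "i < n" for z i
    using W[OF that(2)] W1 wt(1)[OF that(2)] bounds(1)[OF that] by (intro mult_mono) auto
  have "wnorm x \<le> (\<Sum>i<n. W * ?E)" unfolding wnorm_def z'(3) using le[OF z'(1)] by (intro sum_mono) auto
  moreover have "- potential z \<le> (\<Sum>i<n. W * ?E)" unfolding potential_def sum_negf[symmetric]
  proof (rule sum_mono)
    fix i assume "i \<in> {..<n}"
    then have i: "i < n" by simp
    have "- (w i * signed z $ i) \<le> w i * \<bar>signed z $ i\<bar>"
      using mult_left_mono[OF abs_ge_minus_self w0[OF i], of "signed z $ i"] by simp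
    also have "\<dots> \<le> W * ?E" using le[OF z i] abs_signed[OF z i] by simp
    finally show "- (w i * signed z $ i) \<le> W * ?E" .
  qed
  ultimately have gap: "wnorm x - potential z \<le> 2 * (real n * W * ?E)" by simp
  show ?thesis
  proof (rule geometric_count_bound)
    assume "0 < k"
    then have "2 * (1 - 2 * s) * (1 / ?E) \<le> (2 * s) ^ (k - 1) * (wnorm x - potential z)"
      using gnm_run_gap[OF run z bounds(2)] by blast
    also have "\<dots> \<le> (2 * s) ^ (k - 1) * (2 * (real n * W * ?E))"
      using gap s_pos by (intro mult_left_mono) auto
    finally show "2 * (1 - 2 * s) * (1 / ?E) \<le> (2 * s) ^ (k - 1) * (2 * (real n * W * ?E))" .
  next
    show "real n \<le> K"
      using mult_left_mono[of 1 "real_of_int L" "real n"] L_bounds(3) by (simp add: K_def)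
  qed (use K s_pos W1 in \<open>auto simp: K_def\<close>)
qed

text \<open>Under \<open>ln\<close> stands the bound on the resolvent weights, with (2 K)^n bounding
  the entries of R and \<delta> in the role of s - \<rho>. The nested powers n and n - 1 make the
  logarithm quadratic in n.\<close>

lemma weight_bound:
  assumes K: "2 \<le> real n * real_of_int L" and \<delta>: "0 < \<delta>" "\<delta> \<le> 1"
  defines "K \<equiv> real n * real_of_int L"
  shows "ln (fact n * ((2 * K) ^ n + 1) ^ (n - 1) / \<delta> ^ n)
    \<le> (4 * real n ^ 2 + real n * (- ln \<delta> / ln 2)) * ln K"
proof -
  have K2: "2 \<le> K" using K by (simp add: K_def)
  have "1 \<le> K" "0 < K" "0 \<le> ln K" "ln 2 \<le> ln K" using K2 by auto
  have "fact n * 1 \<le> fact n * real_of_int L ^ n" using L_bounds(3) by (intro mult_left_mono) auto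
  then have fact: "fact n \<le> K ^ n" unfolding K_def using fact_L_le by linarith
  have "(2 * K) ^ n \<le> (K * K) ^ n" using K2 by (intro power_mono mult_right_mono) auto
  also have "\<dots> = K ^ (2 * n)" by (simp add: power_even_eq power2_eq_square power_mult_distrib)
  finally have "(2 * K) ^ n + 1 \<le> K ^ (2 * n) + K ^ (2 * n)"
    using one_le_power[OF \<open>1 \<le> K\<close>, of "2 * n"] by linarith
  also have "\<dots> = 2 * K ^ (2 * n)" by simp
  also have "\<dots> \<le> K * K ^ (2 * n)" using K2 by (intro mult_right_mono) auto
  finally have "((2 * K) ^ n + 1) ^ (n - 1) \<le> (K ^ (2 * n + 1)) ^ (n - 1)"
    using K2 by (intro power_mono) auto
  also have "\<dots> \<le> (K ^ (2 * n + 1)) ^ n"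
    using one_le_power[OF \<open>1 \<le> K\<close>, of "2 * n + 1"] by (intro power_increasing) auto
  finally have "fact n * ((2 * K) ^ n + 1) ^ (n - 1) \<le> K ^ n * (K ^ (2 * n + 1)) ^ n"
    using fact K2 by (intro mult_mono) auto
  also have "\<dots> = K ^ (2 * n\<^sup>2 + 2 * n)"
    by (simp flip: power_mult power_add add: power2_eq_square algebra_simps)
  finally have "fact n * ((2 * K) ^ n + 1) ^ (n - 1) / \<delta> ^ n \<le> K ^ (2 * n\<^sup>2 + 2 * n) / \<delta> ^ n"
    using \<delta> by (intro divide_right_mono) auto
  then have "ln (fact n * ((2 * K) ^ n + 1) ^ (n - 1) / \<delta> ^ n) \<le> ln (K ^ (2 * n\<^sup>2 + 2 * n) / \<delta> ^ n)"
    using \<delta> \<open>0 < K\<close> by (intro ln_mono) (auto intro!: divide_pos_pos mult_pos_pos zero_less_power add_pos_pos)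
  also have "\<dots> = real (2 * n\<^sup>2 + 2 * n) * ln K + real n * - ln \<delta>"
    using \<delta> \<open>0 < K\<close> by (simp add: ln_div ln_realpow)
  also have "real (2 * n\<^sup>2 + 2 * n) * ln K \<le> (4 * real n ^ 2) * ln K"
  proof (rule mult_right_mono)
    have "1 * real n \<le> real n * real n" using n by (intro mult_right_mono) auto
    then show "real (2 * n\<^sup>2 + 2 * n) \<le> 4 * real n ^ 2" by (simp add: power2_eq_square)
  qed fact
  also have "real n * - ln \<delta> \<le> real n * (- ln \<delta> / ln 2 * ln K)"
  proof (rule mult_left_mono)
    have "- ln \<delta> / ln 2 * ln 2 \<le> - ln \<delta> / ln 2 * ln K"
      using \<delta> \<open>ln 2 \<le> ln K\<close> by (intro mult_left_mono) (auto simp: divide_nonpos_pos)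
    then show "- ln \<delta> \<le> - ln \<delta> / ln 2 * ln K" by simp
  qed simp
  finally show ?thesis by (simp add: algebra_simps)
qed

end

theorem corollary5p2:
  fixes \<rho> :: real
  assumes "\<rho> < 1 / 2"
  shows "\<exists>C1 C2 :: real.
    \<forall>(n :: nat) (Q :: real mat) (q :: real vec)
      (Qbar :: int mat) (qbar :: int vec) (dQ :: int) (dq :: int).
      n \<ge> 1 \<longrightarrow>
      Qbar \<in> carrier_mat n n \<longrightarrow> qbar \<in> carrier_vec n \<longrightarrow> dQ > 0 \<longrightarrow> dq > 0 \<longrightarrow>
      Q = (1 / real_of_int dQ) \<cdot>\<^sub>m map_mat real_of_int Qbar \<longrightarrow>
      q = (1 / real_of_int dq) \<cdot>\<^sub>v map_vec real_of_int qbar \<longrightarrow>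
      invertible_mat (1\<^sub>m n - Q) \<longrightarrow> invertible_mat (1\<^sub>m n + Q) \<longrightarrow>
      real_spectral_radius (abs_mat (cayley n Q)) \<le> \<rho> \<longrightarrow>
      (\<forall>z \<in> sign_vecs n. invertible_mat (ave_mat n Q - Diag z)) \<and>
      (\<exists>x.
        ave_solution n (ave_mat n Q) (ave_rhs n Q q) x \<and>
        (\<forall>y. ave_solution n (ave_mat n Q) (ave_rhs n Q q) y \<longrightarrow> y = x) \<and>
        (let u = (1 / 2) \<cdot>\<^sub>v (abs_vec x + x); v = (1 / 2) \<cdot>\<^sub>v (abs_vec x - x) in
          lcp_solution n Q q u v \<and>
          (\<forall>u' v'. lcp_solution n Q q u' v' \<longrightarrow> u' = u \<and> v' = v)) \<and>
        (\<forall>z \<in> sign_vecs n. \<exists>k.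
          gnm_run (ave_mat n Q) (ave_rhs n Q q) z k x \<and>
          real k \<le> C1 * real n ^ 3 * ln (real n * real_of_int (Lbar Qbar qbar dQ dq)) \<and>
          (one_norm_mat (cayley n Q) \<le> \<rho> \<longrightarrow>
            real k \<le> C2 * real n ^ 2 * ln (real n * real_of_int (Lbar Qbar qbar dQ dq)))))"
proof -
  \<comment> \<open>The midpoint leaves room on both sides: s - \<rho> > 0 for the weights and 2 s <
    1 for the decay. All constants below depend on \<rho> alone.\<close>
  define s where "s = (\<rho> + 1 / 2) / 2"
  define \<theta> where "\<theta> = - ln (2 * s)"
  define c1 where "c1 = - ln (1 - 2 * s) / ln 2"
  define c2 where "c2 = - ln (s - \<rho>) / ln 2"
  \<comment> \<open>Here 9 = 4 + 2 + 3 and, in \<open>C2\<close>, 5 = 2 + 3 add up the numerical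
    coefficients of the powers of n.\<close>
  define C1 where "C1 = 1 / ln 2 + (c1 + 9 + c2) / \<theta>"
  define C2 where "C2 = 1 / ln 2 + (c1 + 5) / \<theta>"
  have main: "(\<forall>z \<in> sign_vecs n. invertible_mat (ave_mat n Q - Diag z)) \<and>
      (\<exists>x.
        ave_solution n (ave_mat n Q) (ave_rhs n Q q) x \<and>
        (\<forall>y. ave_solution n (ave_mat n Q) (ave_rhs n Q q) y \<longrightarrow> y = x) \<and>
        (let u = (1 / 2) \<cdot>\<^sub>v (abs_vec x + x); v = (1 / 2) \<cdot>\<^sub>v (abs_vec x - x) in
          lcp_solution n Q q u v \<and>
          (\<forall>u' v'. lcp_solution n Q q u' v' \<longrightarrow> u' = u \<and> v' = v)) \<and>
        (\<forall>z \<in> sign_vecs n. \<exists>k.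
          gnm_run (ave_mat n Q) (ave_rhs n Q q) z k x \<and>
          real k \<le> C1 * real n ^ 3 * ln (real n * real_of_int (Lbar Qbar qbar dQ dq)) \<and>
          (one_norm_mat (cayley n Q) \<le> \<rho> \<longrightarrow>
            real k \<le> C2 * real n ^ 2 * ln (real n * real_of_int (Lbar Qbar qbar dQ dq)))))"
    if "rational_lcp n Q q Qbar qbar dQ dq" and sr: "real_spectral_radius (abs_mat (cayley n Q)) \<le> \<rho>"
    for n Q q Qbar qbar dQ dq
  proof -
    interpret rational_lcp n Q q Qbar qbar dQ dq by fact
    let ?K = "real n * real_of_int L"
    have absR: "abs_mat R \<in> carrier_mat n n" using R by (simp add: abs_mat_def)
    have absR_nth: "abs_mat R $$ (i, j) = \<bar>R $$ (i, j)\<bar>" if "i < n" "j < n" for i j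
      using R that by (simp add: abs_mat_def)
    have "map_mat complex_of_real (abs_mat R) \<in> carrier_mat n n" using absR by simp
    \<comment> \<open>For n >= 1 the spectral radius is the modulus of an eigenvalue, which forces
      \<rho> >= 0.\<close>
    from spectral_radius_mem_max(1)[OF this] n
    have "0 \<le> real_spectral_radius (abs_mat R)" by (auto simp: real_spectral_radius_def)
    then have \<rho>0: "0 \<le> \<rho>" using sr by simp
    have s_bounds: "0 < s" "s < 1 / 2" "\<rho> < s" using \<rho>0 assms by (auto simp: s_def)
    have \<theta>: "0 < \<theta>" and c: "0 \<le> c1" "0 \<le> c2"
      using s_bounds \<rho>0 by (auto simp: \<theta>_def c1_def c2_def divide_nonpos_pos)
    have K: "2 \<le> ?K" using two_le_size[OF sr] assms by simp
    then have lnK: "0 \<le> ln ?K" by simp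
    define W where "W = fact n * ((2 * ?K) ^ n + 1) ^ (n - 1) / (s - \<rho>) ^ n"
    have "\<exists>w. \<forall>j<n. 1 \<le> w j \<and> (\<Sum>i<n. w i * abs_mat R $$ (i, j)) \<le> s * w j \<and> w j \<le> W"
      unfolding W_def
      by (rule nonneg_mat_weights[OF absR _ _ _ sr]) (use n \<rho>0 s_bounds absR_nth cayley_abs_le in auto)
    then obtain w where wt: "\<And>j. j < n \<Longrightarrow> 1 \<le> w j" "\<And>j. j < n \<Longrightarrow> w j \<le> W"
        "\<And>j. j < n \<Longrightarrow> (\<Sum>i<n. w i * \<bar>R $$ (i, j)\<bar>) \<le> s * w j"
      using absR_nth by (auto cong: sum.cong_simp)
    interpret weighted_ave n A R b w s
      by (rule weighted_ave_cayley[OF wt(1,3) less_imp_le[OF s_bounds(1)] s_bounds(2)])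
    have run: "\<exists>k x. gnm_run A b z k x" if z: "z \<in> sign_vecs n" for z
    proof (rule gnm_run_exists[OF z])
      show "0 < 1 / ?K ^ (n + 1)" using K by simp
    qed (use gnm_point_bounds invertible_shifted gnm_point_carrier gnm_point_eq(1) in blast)+
    \<comment> \<open>Existence of a solution: the run started at the all-ones vector ends in
      one.\<close>
    have "vec n (\<lambda>_. 1) \<in> sign_vecs n" by (auto simp: sign_vecs_def)
    then obtain x where x: "ave_solution n A b x" using run gnm_run_solution by blast
    have uniq: "y = x" if "ave_solution n A b y" for y by (rule ave_solution_unique[OF x that])
    have lcp: "u' = (1 / 2) \<cdot>\<^sub>v (abs_vec x + x) \<and> v' = (1 / 2) \<cdot>\<^sub>v (abs_vec x - x)"
      if "lcp_solution n Q q u' v'" for u' v'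
      using lcp_imp_ave[OF that] uniq by metis
    have count: "\<exists>k. gnm_run A b z k x \<and> real k \<le> C1 * real n ^ 3 * ln ?K \<and>
        (one_norm_mat R \<le> \<rho> \<longrightarrow> real k \<le> C2 * real n ^ 2 * ln ?K)" if z: "z \<in> sign_vecs n" for z
    proof -
      obtain k x' where "gnm_run A b z k x'" using run[OF z] by blast
      then have k: "gnm_run A b z k x" using uniq gnm_run_solution z by blast
      have n1: "1 \<le> real n" using n by simp
      have n2: "real n \<le> real n ^ 2" "1 \<le> real n ^ 2" using n1 by (auto intro: self_le_power)
      have n3: "real n ^ 2 \<le> real n ^ 3" using n1 by (intro power_increasing) auto
      have "real k \<le> ln ?K / ln 2 + (c1 * ln ?K + ln W + (2 * real n + 3) * ln ?K) / \<theta>"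
        using gnm_run_bound[OF wt(1,3,2) s_bounds(1,2) K z k] by (simp add: c1_def \<theta>_def)
      also have "\<dots> \<le> ln ?K / ln 2 + (c1 * ln ?K + (4 * real n ^ 2 + real n * c2) * ln ?K
          + (2 * real n + 3) * ln ?K) / \<theta>"
      proof -
        have "ln W \<le> (4 * real n ^ 2 + real n * c2) * ln ?K"
          using weight_bound[OF K, of "s - \<rho>"] s_bounds \<rho>0 unfolding W_def c2_def by linarith
        then have "c1 * ln ?K + ln W + (2 * real n + 3) * ln ?K
            \<le> c1 * ln ?K + (4 * real n ^ 2 + real n * c2) * ln ?K + (2 * real n + 3) * ln ?K"
          by (rule add_right_mono[OF add_left_mono])
        from divide_right_mono[OF this, of \<theta>] show ?thesis using \<theta> by linarith
      qed
      also have "\<dots> = (1 / ln 2 + (c1 + 4 * real n ^ 2 + real n * c2 + 2 * real n + 3) / \<theta>) * ln ?K"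
        by (simp add: add_divide_distrib algebra_simps)
      \<comment> \<open>The estimate reached is quadratic in n; n <= n^2 <= n^3 puts it into the
        cubic form.\<close>
      also have "\<dots> \<le> (C1 * real n ^ 3) * ln ?K"
      proof (rule mult_right_mono[OF _ lnK])
        have "c1 * 1 \<le> c1 * real n ^ 3" "real n * c2 \<le> real n ^ 3 * c2"
          by (rule mult_left_mono mult_right_mono; use c n2 n3 in linarith)+
        then have "c1 + 4 * real n ^ 2 + real n * c2 + 2 * real n + 3 \<le> (c1 + 9 + c2) * real n ^ 3"
          using n2 n3 unfolding distrib_right by (simp only: mult.commute[of _ c2])
        then have "(c1 + 4 * real n ^ 2 + real n * c2 + 2 * real n + 3) / \<theta> \<le> (c1 + 9 + c2) * real n ^ 3 / \<theta>"
          using \<theta> by (intro divide_right_mono) auto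
        moreover have "1 / ln 2 * 1 \<le> 1 / ln 2 * real n ^ 3" using n2 n3 by (intro mult_left_mono) auto
        ultimately show "1 / ln 2 + (c1 + 4 * real n ^ 2 + real n * c2 + 2 * real n + 3) / \<theta> \<le> C1 * real n ^ 3"
          unfolding C1_def distrib_right times_divide_eq_left mult_1_right by linarith
      qed
      finally have i: "real k \<le> C1 * real n ^ 3 * ln ?K" .
      have ii: "real k \<le> C2 * real n ^ 2 * ln ?K" if norm: "one_norm_mat R \<le> \<rho>"
      proof -
        have "(\<Sum>i<n. 1 * \<bar>R $$ (i, j)\<bar>) \<le> s * 1" if j: "j < n" for j
        proof -
          have "(\<Sum>i<n. 1 * \<bar>R $$ (i, j)\<bar>) \<le> one_norm_mat R"
            unfolding one_norm_mat_def using R j by (intro Max_ge) auto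
          then show ?thesis using norm s_bounds by simp
        qed
        \<comment> \<open>With all weights 1 one may take W = 1, and ln W, the source of the
          quadratic term, vanishes.\<close>
        from gnm_run_bound[OF _ this _ s_bounds(1,2) K z k, of 1]
        have "real k \<le> ln ?K / ln 2 + (c1 * ln ?K + (2 * real n + 3) * ln ?K) / \<theta>"
          by (simp add: c1_def \<theta>_def)
        also have "\<dots> = (1 / ln 2 + (c1 + 2 * real n + 3) / \<theta>) * ln ?K"
          by (simp add: add_divide_distrib algebra_simps)
        also have "\<dots> \<le> (C2 * real n ^ 2) * ln ?K"
        proof (rule mult_right_mono[OF _ lnK])
          have "c1 * 1 \<le> c1 * real n ^ 2" using c n2 by (intro mult_left_mono) auto
          then have "c1 + 2 * real n + 3 \<le> (c1 + 5) * real n ^ 2"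
            using n2 unfolding distrib_right by linarith
          then have "(c1 + 2 * real n + 3) / \<theta> \<le> (c1 + 5) * real n ^ 2 / \<theta>"
            using \<theta> by (intro divide_right_mono) auto
          moreover have "1 / ln 2 * 1 \<le> 1 / ln 2 * real n ^ 2" using n2 by (intro mult_left_mono) auto
          ultimately show "1 / ln 2 + (c1 + 2 * real n + 3) / \<theta> \<le> C2 * real n ^ 2"
            unfolding C2_def distrib_right times_divide_eq_left mult_1_right by linarith
        qed
        finally show ?thesis .
      qed
      show ?thesis using k i ii by blast
    qed
    show ?thesis unfolding Let_def
      by (intro conjI ballI exI[of _ x] allI impI; (fact invertible_shifted x uniq ave_imp_lcp[OF x] count)?)
        (use lcp in blast)+
  qed
  show ?thesis
    by (intro exI[of _ C1] exI[of _ C2] allI impI, rule main) (unfold_locales, auto)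
qed

end
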